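(* Let $H_i$ be $k$-uniform hypergraphs on the vertex sets $X_i$ ($i\ge1$), let $\mathbf H=[\{S_{H_i}\}]\subseteq\mathbf X^{[k]}$ be their ultralimit, let $\{l(A),F_A\}_{\emptyset\neq A\subseteq[k]}$ be a separable realization of degree $k$ on $\mathbf X^{[k]}$, let $F=\bigoplus_{\emptyset\ne A\subseteq[k]}F_A:\mathbf X^{[k]}\to[0,1]^{2^k-1}$, let $Q\subseteq[0,1]^{2^k-1}$ be an $S_k$-invariant Lebesgue measurable set with $\mu_{[k]}(F^{-1}(Q)\triangle\mathbf H)=0$, and let $W_{\mathbf H}=1_Q$. Then for every fixed $k$-uniform hypergraph $K$ on the vertex set $[n]$, $$\lim_\omega t(K,H_i)=t(K,W_{\mathbf H}).$$
   Context: Let $X_1,X_2,\dots$ be finite sets with $|X_1|<|X_2|<\cdots$ and $\omega$ a nonprincipal ultrafilter on $\mathbb N$, $\lim_\omega$ the ultralimit of bounded sequences. For finite sets $Y_i$ the ultraproduct is $\prod_iY_i$ modulo $(p_i)\sim(q_i)\iff\{i:p_i=q_i\}\in\omega$; for $A_i\subseteq Y_i$ the set $[\{A_i\}]$ consists of classes $[(p_i)]$ with $\{i:p_i\in A_i\}\in\omega$; these form a Boolean algebra $\mathcal P$ with finitely additive measure $\mu([\{A_i\}])=\lim_\omega|A_i|/|Y_i|$; nullsets are sets contained, for each $\epsilon>0$, in some member of $\mathcal P$ of measure $\le\epsilon$; measurable sets are those differing from a member of $\mathcal P$ by a nullset, forming a $\sigma$-algebra with a probability measure extending $\mu$. For $A\subseteq[k]$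 let $\mathbf X^A$ be the ultraproduct of $X_i^A$ with measurable sets $\mathcal B_A$ and measure $\mu_A$; write $\mu=\mu_{[k]}$; $p_A:\mathbf X^{[k]}\to\mathbf X^A$ is induced by coordinate projection, $\sigma(A)=p_A^{-1}(\mathcal B_A)$, and for nonempty $A$, $\sigma(A)^*$ is generated by $\sigma(B)$, $B\subseteq A$, $|B|=|A|-1$. $S_k$ acts on $\mathbf X^{[k]}$ by $(x_1,\dots,x_k)^\pi=(x_{\pi^{-1}(1)},\dots,x_{\pi^{-1}(k)})$, on sets and $\sigma$-algebras elementwise, on subsets of $[k]$ by $A^\pi=\pi(A)$, and on $[0,1]^{2^k-1}$ (coordinates $y_A$ indexed by nonempty $A\subseteq[k]$) by $(y_A)_A^\pi=(y_{\pi^{-1}(A)})_A$; $S_A$ is the group of permutations of $[k]$ fixing all points outside $A$. A separable realization of degree $k$ is a system of atomless separable (i.e. with separable measure algebra) $\sigma$-algebras $l(A)$ and functions $F_A:\mathbf X^{[k]}\to[0,1]$, $\emptyset\ne A\subseteq[k]$, with: (1) $l(A)\subseteq\sigma(A)$, independent from $\sigma(A)^*$; (2) $l(A)^\pi=l(A^\pi)$ for $\pi\in S_k$; (3) $S^\pi=S$ for $S\in l(A)$, $\pi\in S_A$; (4) $F_A$ is $l(A)$-measurable and $U\mapsto F_A^{-1}(U)$ induces an isomorphism of the measure algebras of $([0,1],\text{Borel},\lambda)$ and $(\mathbf X^{[k]},l(A),\mu)$; (5) $F_A(x)=F_{A^\pi}(x^\pi)$ for all $x,\pi,A$. A $k$-uniform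 hypergraph $H$ on a set $V$ is a set $E(H)$ of $k$-element subsets of $V$; $S_H\subseteq V^k$ is the set of $(x_1,\dots,x_k)$ with $\{x_1,\dots,x_k\}\in E(H)$. For $K$ on $[n]$ and finite $H$ on $V$, a homomorphism is a map $f:[n]\to V$ mapping every edge of $K$ onto an edge of $H$, and $t(K,H)=\hom(K,H)/|V|^n$. For an $S_k$-invariant measurable $W:[0,1]^{2^k-1}\to\{0,1\}$, let $\mathcal C_K$ be the set of nonempty subsets of edges of $K$, fix for each $E\in E(K)$ a bijection $s_E:[k]\to E$, and set $t(K,W)=\int_{[0,1]^{\mathcal C_K}}\prod_{E\in E(K)}W\big((x_{s_E(A)})_{\emptyset\ne A\subseteq[k]}\big)\,d(x_C)_{C\in\mathcal C_K}$ (Lebesgue measure). *)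

theory Defs
  imports "HOL-Probability.Probability"
begin

section \<open>Ultraproducts of finite sets and their measure\<close>

text \<open>A filter is identified with the family of index sets on which a property eventually
  holds, so a set \<open>I\<close> belongs to \<open>\<omega>\<close> iff \<open>eventually (\<lambda>i. i \<in> I) \<omega>\<close>, and the ultralimit of a
  sequence is its limit along the filter.\<close>

definition nonprincipal_ultrafilter :: "nat filter \<Rightarrow> bool" where
  "nonprincipal_ultrafilter \<omega> \<longleftrightarrow>
     \<omega> \<noteq> bot \<and>
     (\<forall>P. eventually P \<omega> \<or> eventually (\<lambda>i. \<not> P i) \<omega>) \<and>
     (\<forall>n. \<not> eventually (\<lambda>i. i = n) \<omega>)"

definition ultra_rel :: "nat filter \<Rightarrow> (nat \<Rightarrow> 'b set) \<Rightarrow> ((nat \<Rightarrow> 'b) \<times> (nat \<Rightarrow> 'b)) set" where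
  "ultra_rel \<omega> Y = {(p, q). (\<forall>i. p i \<in> Y i) \<and> (\<forall>i. q i \<in> Y i) \<and> (\<forall>\<^sub>F i in \<omega>. p i = q i)}"

definition ultraproduct :: "nat filter \<Rightarrow> (nat \<Rightarrow> 'b set) \<Rightarrow> (nat \<Rightarrow> 'b) set set" where
  "ultraproduct \<omega> Y = {p. \<forall>i. p i \<in> Y i} // ultra_rel \<omega> Y"

definition internal_set ::
    "nat filter \<Rightarrow> (nat \<Rightarrow> 'b set) \<Rightarrow> (nat \<Rightarrow> 'b set) \<Rightarrow> (nat \<Rightarrow> 'b) set set" where
  "internal_set \<omega> Y A = {c \<in> ultraproduct \<omega> Y. \<exists>p\<in>c. \<forall>\<^sub>F i in \<omega>. p i \<in> A i}"

definition internal_sets :: "nat filter \<Rightarrow> (nat \<Rightarrow> 'b set) \<Rightarrow> (nat \<Rightarrow> 'b) set set set" where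
  "internal_sets \<omega> Y = {internal_set \<omega> Y A | A. \<forall>i. A i \<subseteq> Y i}"

definition internal_measure :: "nat filter \<Rightarrow> (nat \<Rightarrow> 'b set) \<Rightarrow> (nat \<Rightarrow> 'b) set set \<Rightarrow> real" where
  "internal_measure \<omega> Y S =
     (THE r. \<exists>A. (\<forall>i. A i \<subseteq> Y i) \<and> S = internal_set \<omega> Y A \<and>
                 ((\<lambda>i. real (card (A i)) / real (card (Y i))) \<longlongrightarrow> r) \<omega>)"

definition ultra_null :: "nat filter \<Rightarrow> (nat \<Rightarrow> 'b set) \<Rightarrow> (nat \<Rightarrow> 'b) set set \<Rightarrow> bool" where
  "ultra_null \<omega> Y N \<longleftrightarrow>
     N \<subseteq> ultraproduct \<omega> Y \<and>
     (\<forall>\<epsilon>>0. \<exists>P\<in>internal_sets \<omega> Y. N \<subseteq> P \<and> internal_measure \<omega> Y P \<le> \<epsilon>)"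

definition ultra_sets :: "nat filter \<Rightarrow> (nat \<Rightarrow> 'b set) \<Rightarrow> (nat \<Rightarrow> 'b) set set set" where
  "ultra_sets \<omega> Y =
     {B. B \<subseteq> ultraproduct \<omega> Y \<and> (\<exists>P\<in>internal_sets \<omega> Y. ultra_null \<omega> Y (sym_diff B P))}"

definition ultra_value :: "nat filter \<Rightarrow> (nat \<Rightarrow> 'b set) \<Rightarrow> (nat \<Rightarrow> 'b) set set \<Rightarrow> real" where
  "ultra_value \<omega> Y B =
     (THE r. \<exists>P\<in>internal_sets \<omega> Y. ultra_null \<omega> Y (sym_diff B P) \<and> r = internal_measure \<omega> Y P)"

definition ultra_measure :: "nat filter \<Rightarrow> (nat \<Rightarrow> 'b set) \<Rightarrow> (nat \<Rightarrow> 'b) set measure" where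
  "ultra_measure \<omega> Y =
     measure_of (ultraproduct \<omega> Y) (ultra_sets \<omega> Y) (\<lambda>B. ennreal (ultra_value \<omega> Y B))"

text \<open>The map between ultraproducts (into that of \<open>Z\<close>) induced by applying \<open>f\<close> in every index.\<close>

definition ultra_map ::
    "nat filter \<Rightarrow> (nat \<Rightarrow> 'c set) \<Rightarrow> ('b \<Rightarrow> 'c) \<Rightarrow> (nat \<Rightarrow> 'b) set \<Rightarrow> (nat \<Rightarrow> 'c) set" where
  "ultra_map \<omega> Z f c = {q. (\<forall>i. q i \<in> Z i) \<and> (\<exists>p\<in>c. \<forall>\<^sub>F i in \<omega>. q i = f (p i))}"


section \<open>Powers of the ultraproduct\<close>

text \<open>The set \<open>[k]\<close> is \<open>{1..k}\<close> and \<open>X i ^ A\<close> is the extensional function space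
  \<open>A \<rightarrow>\<^sub>E X i\<close>.\<close>

type_synonym 'a upoint = "(nat \<Rightarrow> nat \<Rightarrow> 'a) set"

definition powers :: "(nat \<Rightarrow> 'a set) \<Rightarrow> nat set \<Rightarrow> nat \<Rightarrow> (nat \<Rightarrow> 'a) set" where
  "powers X A = (\<lambda>i. A \<rightarrow>\<^sub>E X i)"

definition upower :: "nat filter \<Rightarrow> (nat \<Rightarrow> 'a set) \<Rightarrow> nat set \<Rightarrow> 'a upoint set" where
  "upower \<omega> X A = ultraproduct \<omega> (powers X A)"

definition upower_measure :: "nat filter \<Rightarrow> (nat \<Rightarrow> 'a set) \<Rightarrow> nat set \<Rightarrow> 'a upoint measure" where
  "upower_measure \<omega> X A = ultra_measure \<omega> (powers X A)"

definition uproj :: "nat filter \<Rightarrow> (nat \<Rightarrow> 'a set) \<Rightarrow> nat set \<Rightarrow> 'a upoint \<Rightarrow> 'a upoint" where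
  "uproj \<omega> X A = ultra_map \<omega> (powers X A) (\<lambda>x. restrict x A)"

definition sigma_proj ::
    "nat filter \<Rightarrow> (nat \<Rightarrow> 'a set) \<Rightarrow> nat \<Rightarrow> nat set \<Rightarrow> 'a upoint set set" where
  "sigma_proj \<omega> X k A =
     {uproj \<omega> X A -` B \<inter> upower \<omega> X {1..k} | B. B \<in> sets (upower_measure \<omega> X A)}"

definition sigma_star ::
    "nat filter \<Rightarrow> (nat \<Rightarrow> 'a set) \<Rightarrow> nat \<Rightarrow> nat set \<Rightarrow> 'a upoint set set" where
  "sigma_star \<omega> X k A =
     sigma_sets (upower \<omega> X {1..k})
       (\<Union>B\<in>{B. B \<subseteq> A \<and> card B = card A - 1}. sigma_proj \<omega> X k B)"

definition uperm ::
    "nat filter \<Rightarrow> (nat \<Rightarrow> 'a set) \<Rightarrow> nat \<Rightarrow> (nat \<Rightarrow> nat) \<Rightarrow> 'a upoint \<Rightarrow> 'a upoint" where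
  "uperm \<omega> X k \<pi> = ultra_map \<omega> (powers X {1..k}) (\<lambda>x. \<lambda>j\<in>{1..k}. x (inv \<pi> j))"


section \<open>Measure algebras\<close>

definition null_rel :: "'b measure \<Rightarrow> ('b set \<times> 'b set) set" where
  "null_rel M = {(S, T). S \<in> sets M \<and> T \<in> sets M \<and> emeasure M (sym_diff S T) = 0}"

definition measure_algebra :: "'b measure \<Rightarrow> 'b set set set" where
  "measure_algebra M = sets M // null_rel M"

definition atomless :: "'b measure \<Rightarrow> bool" where
  "atomless M \<longleftrightarrow>
     (\<forall>S\<in>sets M. 0 < emeasure M S \<longrightarrow>
        (\<exists>T\<in>sets M. T \<subseteq> S \<and> 0 < emeasure M T \<and> emeasure M T < emeasure M S))"

text \<open>Separability of the measure algebra for the metric \<open>d(S, T) = M(S \<triangle> T)\<close>, expressed on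
  representatives.\<close>

definition separable_measure_algebra :: "'b measure \<Rightarrow> bool" where
  "separable_measure_algebra M \<longleftrightarrow>
     (\<exists>D\<subseteq>sets M. countable D \<and>
        (\<forall>S\<in>sets M. \<forall>\<epsilon>>0. \<exists>T\<in>D. emeasure M (sym_diff S T) < ennreal \<epsilon>))"

text \<open>The map \<open>U \<mapsto> f\<^sup>-\<^sup>1(U)\<close> induces an isomorphism from the measure algebra of \<open>M\<close> onto that of
  \<open>N\<close>.  Preservation of measure makes the induced map on classes well defined; it respects the
  Boolean operations because preimages do.\<close>

definition induces_measure_algebra_iso :: "'b measure \<Rightarrow> 'c measure \<Rightarrow> ('b \<Rightarrow> 'c) \<Rightarrow> bool" where
  "induces_measure_algebra_iso N M f \<longleftrightarrow>
     (\<forall>U\<in>sets M. emeasure N (f -` U \<inter> space N) = emeasure M U) \<and>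
     bij_betw (\<lambda>c. null_rel N `` ((\<lambda>U. f -` U \<inter> space N) ` c))
       (measure_algebra M) (measure_algebra N)"


section \<open>Separable realizations\<close>

definition unit_interval :: "real measure" where
  "unit_interval = restrict_space lborel {0..1}"

definition nonempty_subsets :: "nat \<Rightarrow> nat set set" where
  "nonempty_subsets k = {A. A \<noteq> {} \<and> A \<subseteq> {1..k}}"

definition separable_realization ::
    "nat filter \<Rightarrow> (nat \<Rightarrow> 'a set) \<Rightarrow> nat \<Rightarrow> (nat set \<Rightarrow> 'a upoint set set) \<Rightarrow>
     (nat set \<Rightarrow> 'a upoint \<Rightarrow> real) \<Rightarrow> bool" where
  "separable_realization \<omega> X k l F \<longleftrightarrow>
     (let \<Omega> = upower \<omega> X {1..k};
          \<mu> = upower_measure \<omega> X {1..k};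
          M = (\<lambda>A. measure_of \<Omega> (l A) (emeasure \<mu>));
          act = uperm \<omega> X k
      in \<forall>A\<in>nonempty_subsets k.
        sigma_algebra \<Omega> (l A) \<and> atomless (M A) \<and> separable_measure_algebra (M A) \<and>
        l A \<subseteq> sigma_proj \<omega> X k A \<and>
        prob_space.indep_set \<mu> (l A) (sigma_star \<omega> X k A) \<and>
        (\<forall>\<pi>. \<pi> permutes {1..k} \<longrightarrow> (\<lambda>S. act \<pi> ` S) ` l A = l (\<pi> ` A)) \<and>
        (\<forall>S\<in>l A. \<forall>\<pi>. \<pi> permutes A \<longrightarrow> act \<pi> ` S = S) \<and>
        F A \<in> measurable (M A) unit_interval \<and>
        induces_measure_algebra_iso (M A) unit_interval (F A) \<and>
        (\<forall>x\<in>\<Omega>. \<forall>\<pi>. \<pi> permutes {1..k} \<longrightarrow> F A x = F (\<pi> ` A) (act \<pi> x)))"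


section \<open>Lebesgue measure on cubes\<close>

text \<open>The completion of the Borel product measure, so that its sets are the Lebesgue measurable
  subsets of \<open>[0,1]\<^sup>I\<close>.\<close>

definition unit_cube :: "'i set \<Rightarrow> ('i \<Rightarrow> real) measure" where
  "unit_cube I = completion (\<Pi>\<^sub>M i\<in>I. unit_interval)"

definition cube_perm :: "nat \<Rightarrow> (nat \<Rightarrow> nat) \<Rightarrow> (nat set \<Rightarrow> real) \<Rightarrow> (nat set \<Rightarrow> real)" where
  "cube_perm k \<pi> y = (\<lambda>A\<in>nonempty_subsets k. y (inv \<pi> ` A))"

definition perm_invariant :: "nat \<Rightarrow> (nat set \<Rightarrow> real) set \<Rightarrow> bool" where
  "perm_invariant k Q \<longleftrightarrow> (\<forall>\<pi>. \<pi> permutes {1..k} \<longrightarrow> cube_perm k \<pi> ` Q = Q)"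

definition direct_sum_map ::
    "nat \<Rightarrow> (nat set \<Rightarrow> 'p \<Rightarrow> real) \<Rightarrow> 'p \<Rightarrow> (nat set \<Rightarrow> real)" where
  "direct_sum_map k F x = (\<lambda>A\<in>nonempty_subsets k. F A x)"


section \<open>Hypergraphs and homomorphism densities\<close>

text \<open>A hypergraph is given by its edge set.\<close>

definition uniform_hypergraph :: "nat \<Rightarrow> 'v set \<Rightarrow> 'v set set \<Rightarrow> bool" where
  "uniform_hypergraph k V E \<longleftrightarrow> (\<forall>e\<in>E. e \<subseteq> V \<and> finite e \<and> card e = k)"

definition edge_tuples :: "nat \<Rightarrow> 'v set \<Rightarrow> 'v set set \<Rightarrow> (nat \<Rightarrow> 'v) set" where
  "edge_tuples k V E = {x \<in> {1..k} \<rightarrow>\<^sub>E V. x ` {1..k} \<in> E}"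

definition homs :: "nat \<Rightarrow> nat set set \<Rightarrow> 'v set \<Rightarrow> 'v set set \<Rightarrow> (nat \<Rightarrow> 'v) set" where
  "homs n K V E = {f \<in> {1..n} \<rightarrow>\<^sub>E V. \<forall>e\<in>K. f ` e \<in> E}"

definition hom_density :: "nat \<Rightarrow> nat set set \<Rightarrow> 'v set \<Rightarrow> 'v set set \<Rightarrow> real" where
  "hom_density n K V E = real (card (homs n K V E)) / real (card V) ^ n"

definition edge_subsets :: "nat set set \<Rightarrow> nat set set" where
  "edge_subsets K = {C. C \<noteq> {} \<and> (\<exists>e\<in>K. C \<subseteq> e)}"

text \<open>The family \<open>s\<close> supplies the chosen bijections \<open>s e : [k] \<rightarrow> e\<close>.\<close>

definition limit_density ::
    "nat \<Rightarrow> (nat set \<Rightarrow> nat \<Rightarrow> nat) \<Rightarrow> nat set set \<Rightarrow> ((nat set \<Rightarrow> real) \<Rightarrow> real) \<Rightarrow> real" where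
  "limit_density k s K W =
     (LINT x|unit_cube (edge_subsets K).
        (\<Prod>e\<in>K. W (\<lambda>A\<in>nonempty_subsets k. x (s e ` A))))"

end

theory Submission
  imports Defs
begin

text \<open>The obstacle is Fubini. The measurable sets of an ultraproduct of powers form in general
  more than the product of the sigma-algebras of the factors, and they are known only through
  internal sets up to null sets. Sections are therefore never taken of measurable sets. Each
  measurable set is replaced by an internal approximant that respects the same coordinates
  (\<open>coord_approx\<close>), and resampling is a count of points on each finite power. An
  average never exceeds its largest term in absolute value, so one section point per index is
  enough, and measurability of the section in its base point never arises.

  Increasing size matters because an earlier \<open>D\<close> has at most as many points as
  \<open>C\<close>. Then \<open>C \<subseteq> D\<close> would force \<open>D = C\<close>, so some
  point of \<open>C\<close> is invisible to \<open>D\<close>. That missing point puts the section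
  into a sigma-algebra of lower degree.

  A Lebesgue measurable \<open>Q\<close> is exchanged for a set in the product sigma-algebra up to a
  null set. Both coordinate maps into cubes preserve measure, so null sets pull back to null sets
  and the exchange costs nothing.\<close>

text \<open>
  A homomorphism density is the Loeb measure of an intersection of pullbacks of \<open>\<^bold>H\<close>, hence
  of \<open>F\<^sup>-\<^sup>1(Q)\<close>, along the measure preserving maps \<open>X ^ n \<rightarrow> X ^ k\<close> given by the \<open>s e\<close>.  By the symmetry of
  the realization, the function \<open>F A\<close> pulled back along \<open>s e\<close> depends only on \<open>C = s e ` A\<close>;
  call it \<open>G C\<close>.  It suffices that the \<open>G C\<close> are independent and uniform on \<open>[0,1]\<close>.  Adding the
  sets \<open>C\<close> in order of increasing size, one has to decouple \<open>G C\<close> from finitely many \<open>G D\<close> with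
  \<open>C \<subseteq> D\<close> failing.  On the finite level, resampling the coordinates in \<open>C\<close> writes the correlation as
  an average of correlations with sections of the other sets.  In the limit such a section is
  measurable with respect to \<open>sigma_star A\<close>, from which \<open>F A\<close> is independent, so even the worst
  section contributes nothing.
\<close>

section \<open>Loeb measure\<close>

locale ultrafilter_on_nat =
  fixes \<omega> :: "nat filter"
  assumes nonprincipal: "nonprincipal_ultrafilter \<omega>"
begin

lemma nontrivial: "\<omega> \<noteq> bot"
  using nonprincipal by (simp add: nonprincipal_ultrafilter_def)

lemma eventually_not_iff: "eventually (\<lambda>i. \<not> P i) \<omega> \<longleftrightarrow> \<not> eventually P \<omega>"
proof
  assume "eventually (\<lambda>i. \<not> P i) \<omega>"
  show "\<not> eventually P \<omega>"
  proof
    assume "eventually P \<omega>"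
    with \<open>eventually (\<lambda>i. \<not> P i) \<omega>\<close> have "eventually (\<lambda>i. False) \<omega>"
      by eventually_elim simp
    then show False using nontrivial by (simp add: eventually_False)
  qed
qed (use nonprincipal in \<open>auto simp: nonprincipal_ultrafilter_def\<close>)

lemma eventually_ge: "eventually (\<lambda>i. m \<le> i) \<omega>"
proof (induction m)
  case (Suc m)
  have "eventually (\<lambda>i. i \<noteq> m) \<omega>"
    using nonprincipal by (auto simp: eventually_not_iff nonprincipal_ultrafilter_def)
  with Suc show ?case by eventually_elim simp
qed simp

text \<open>By compactness of the interval the image filter has a cluster point. An ultrafilter that
  does not eventually lie in a neighbourhood of a point eventually lies outside it, so a cluster
  point is already a limit.\<close>

lemma bounded_tendsto_exists:
  fixes f :: "nat \<Rightarrow> real"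
  assumes "\<And>i. f i \<in> {a..b}"
  shows "\<exists>L. (f \<longlongrightarrow> L) \<omega>"
proof -
  have nb: "filtermap f \<omega> \<noteq> bot"
    using nontrivial by (simp add: filtermap_bot_iff)
  have "eventually (\<lambda>x. x \<in> {a..b}) (filtermap f \<omega>)"
    using assms by (simp add: eventually_filtermap)
  then obtain L where L: "inf (nhds L) (filtermap f \<omega>) \<noteq> bot"
    using nb compact_Icc[of a b] unfolding compact_filter by blast
  have "(f \<longlongrightarrow> L) \<omega>"
  proof (rule topological_tendstoI, rule ccontr)
    fix S assume S: "open S" "L \<in> S" "\<not> (\<forall>\<^sub>F x in \<omega>. f x \<in> S)"
    then have "eventually (\<lambda>x. x \<notin> S) (filtermap f \<omega>)"
      by (simp add: eventually_filtermap eventually_not_iff)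
    moreover have "eventually (\<lambda>x. x \<in> S) (nhds L)"
      using S by (metis eventually_nhds)
    ultimately have "eventually (\<lambda>x. False) (inf (nhds L) (filtermap f \<omega>))"
      unfolding eventually_inf by blast
    with L show False by (simp add: eventually_False)
  qed
  then show ?thesis ..
qed

end

section \<open>Internal sets of an ultraproduct and their limit densities\<close>

locale ultra_space = ultrafilter_on_nat +
  fixes Y :: "nat \<Rightarrow> 'b set"
  assumes fin: "\<And>i. finite (Y i)" and ne: "\<And>i. Y i \<noteq> {}"
begin

abbreviation "\<Omega> \<equiv> ultraproduct \<omega> Y"
abbreviation "internal \<equiv> internal_set \<omega> Y"
abbreviation "null \<equiv> ultra_null \<omega> Y"

definition cls :: "(nat \<Rightarrow> 'b) \<Rightarrow> (nat \<Rightarrow> 'b) set" where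
  "cls p = {q. (\<forall>i. q i \<in> Y i) \<and> (\<forall>\<^sub>F i in \<omega>. p i = q i)}"

lemma cls_eq_Image: "(\<And>i. p i \<in> Y i) \<Longrightarrow> cls p = ultra_rel \<omega> Y `` {p}"
  by (auto simp: cls_def ultra_rel_def)

lemma ultraproduct_eq: "\<Omega> = cls ` {p. \<forall>i. p i \<in> Y i}"
  by (auto simp: ultraproduct_def quotient_def cls_eq_Image)

lemma cls_in[simp]: "(\<And>i. p i \<in> Y i) \<Longrightarrow> cls p \<in> \<Omega>"
  by (auto simp: ultraproduct_eq)

lemma ultraproductE:
  assumes "c \<in> \<Omega>" obtains p where "\<And>i. p i \<in> Y i" "c = cls p"
  using assms by (auto simp: ultraproduct_eq)

lemma cls_internal_iff:
  assumes "\<And>i. p i \<in> Y i"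
  shows "cls p \<in> internal A \<longleftrightarrow> (\<forall>\<^sub>F i in \<omega>. p i \<in> A i)"
proof
  assume "cls p \<in> internal A"
  then obtain q where "\<forall>\<^sub>F i in \<omega>. p i = q i" "\<forall>\<^sub>F i in \<omega>. q i \<in> A i"
    by (auto simp: internal_set_def cls_def)
  then show "\<forall>\<^sub>F i in \<omega>. p i \<in> A i" by eventually_elim simp
next
  assume "\<forall>\<^sub>F i in \<omega>. p i \<in> A i"
  moreover have "p \<in> cls p" using assms by (simp add: cls_def)
  ultimately show "cls p \<in> internal A" using assms by (auto simp: internal_set_def)
qed

lemma internal_subset: "internal A \<subseteq> \<Omega>"
  by (auto simp: internal_set_def)

text \<open>Reduces identities between internal sets to classes of representatives. The Boolean laws
  below then become closure properties of the ultrafilter.\<close>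

lemma internal_eqI:
  assumes "S \<subseteq> \<Omega>" "\<And>p. (\<And>i. p i \<in> Y i) \<Longrightarrow> cls p \<in> S \<longleftrightarrow> (\<forall>\<^sub>F i in \<omega>. p i \<in> A i)"
  shows "internal A = S"
proof (intro equalityI subsetI)
  fix c assume "c \<in> internal A"
  then obtain p where "\<And>i. p i \<in> Y i" "c = cls p"
    using internal_subset ultraproductE by blast
  with \<open>c \<in> internal A\<close> assms(2)[of p] show "c \<in> S" by (simp add: cls_internal_iff)
next
  fix c assume "c \<in> S"
  then obtain p where "\<And>i. p i \<in> Y i" "c = cls p"
    using assms(1) ultraproductE by blast
  with \<open>c \<in> S\<close> assms(2)[of p] show "c \<in> internal A" by (simp add: cls_internal_iff)
qed

lemma internal_cong: "(\<And>i. A i \<inter> Y i = B i \<inter> Y i) \<Longrightarrow> internal A = internal B"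
  by (rule internal_eqI[OF internal_subset], subst cls_internal_iff)
    (auto intro!: eventually_cong[OF always_eventually])

lemma internal_Int: "internal (\<lambda>i. A i \<inter> B i) = internal A \<inter> internal B"
  by (rule internal_eqI) (use internal_subset in \<open>auto simp: cls_internal_iff eventually_conj_iff\<close>)

lemma internal_compl: "internal (\<lambda>i. - A i) = \<Omega> - internal A"
  by (rule internal_eqI) (auto simp: cls_internal_iff eventually_not_iff)

lemma internal_Y: "internal Y = \<Omega>"
  by (rule internal_eqI) auto

lemma internal_empty: "internal (\<lambda>i. {}) = {}"
  by (rule internal_eqI) (auto simp: nontrivial)

lemma internal_Diff: "internal (\<lambda>i. A i - B i) = internal A - internal B"
  using internal_Int[of A "\<lambda>i. - B i"] internal_subset[of A]
  by (auto simp: internal_compl Diff_eq)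

lemma internal_Un: "internal (\<lambda>i. A i \<union> B i) = internal A \<union> internal B"
  using internal_compl[of "\<lambda>i. - A i \<inter> - B i"] internal_subset[of A] internal_subset[of B]
  by (auto simp: internal_compl internal_Int)

lemma internal_sym_diff: "internal (\<lambda>i. sym_diff (A i) (B i)) = sym_diff (internal A) (internal B)"
  by (simp add: internal_Un internal_Diff)

lemma internal_UN_atMost: "internal (\<lambda>i. \<Union>j\<le>(m::nat). A j i) = (\<Union>j\<le>m. internal (A j))"
  by (induction m) (simp_all add: atMost_Suc internal_Un)

lemma internal_INT_finite:
  "finite J \<Longrightarrow> internal (\<lambda>i. Y i \<inter> (\<Inter>j\<in>J. A j i)) = \<Omega> \<inter> (\<Inter>j\<in>J. internal (A j))"
proof (induction J rule: finite_induct)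
  case (insert j J)
  have "internal (\<lambda>i. Y i \<inter> (\<Inter>j\<in>insert j J. A j i)) = internal (\<lambda>i. A j i \<inter> (Y i \<inter> (\<Inter>j\<in>J. A j i)))"
    by (rule internal_cong) auto
  also have "\<dots> = internal (A j) \<inter> internal (\<lambda>i. Y i \<inter> (\<Inter>j\<in>J. A j i))"
    by (rule internal_Int)
  finally show ?case using insert.IH by auto
qed (simp add: internal_Y)

text \<open>If the inclusion fails at almost all indices, a counterexample picked at each of them
  forms a representative whose class separates the two internal sets. At the remaining indices any
  point of the nonempty set \<open>Y i\<close> will do.\<close>

lemma internal_mono_iff: "internal A \<subseteq> internal B \<longleftrightarrow> (\<forall>\<^sub>F i in \<omega>. A i \<inter> Y i \<subseteq> B i)"
proof
  assume sub: "internal A \<subseteq> internal B"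
  show "\<forall>\<^sub>F i in \<omega>. A i \<inter> Y i \<subseteq> B i"
  proof (rule ccontr)
    assume "\<not> ?thesis"
    then have ev: "\<forall>\<^sub>F i in \<omega>. \<not> A i \<inter> Y i \<subseteq> B i" by (simp add: eventually_not_iff)
    define p where "p i = (if A i \<inter> Y i \<subseteq> B i then SOME y. y \<in> Y i
       else SOME y. y \<in> A i \<inter> Y i - B i)" for i
    have p: "p i \<in> A i \<inter> Y i - B i" if "\<not> A i \<inter> Y i \<subseteq> B i" for i
      using that someI_ex[of "\<lambda>y. y \<in> A i \<inter> Y i - B i"] by (auto simp: p_def)
    have pY: "p i \<in> Y i" for i
      using p[of i] someI_ex[of "\<lambda>y. y \<in> Y i"] ne[of i]
      by (cases "A i \<inter> Y i \<subseteq> B i") (auto simp: p_def)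
    have "\<forall>\<^sub>F i in \<omega>. p i \<in> A i" "\<forall>\<^sub>F i in \<omega>. p i \<notin> B i"
      using ev p by (auto elim!: eventually_mono)
    with sub cls_internal_iff[OF pY] show False by (auto simp: eventually_not_iff)
  qed
next
  assume ev: "\<forall>\<^sub>F i in \<omega>. A i \<inter> Y i \<subseteq> B i"
  show "internal A \<subseteq> internal B"
  proof
    fix c assume c: "c \<in> internal A"
    then obtain p where p: "\<And>i. p i \<in> Y i" "c = cls p"
      using internal_subset ultraproductE by blast
    with c have "\<forall>\<^sub>F i in \<omega>. p i \<in> A i" by (simp add: cls_internal_iff)
    with ev have "\<forall>\<^sub>F i in \<omega>. p i \<in> B i" by eventually_elim (use p in auto)
    with p show "c \<in> internal B" by (simp add: cls_internal_iff)
  qed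
qed

text \<open>Cutting down to \<open>Y i\<close> lets \<open>A\<close> be an arbitrary sequence, so
  that complements and preimages can be used without the side condition
  \<open>A i \<subseteq> Y i\<close>. By \<open>internal_cong\<close> nothing outside
  \<open>Y i\<close> matters for \<open>internal\<close> either.\<close>

definition dens :: "(nat \<Rightarrow> 'b set) \<Rightarrow> nat \<Rightarrow> real" where
  "dens A i = real (card (A i \<inter> Y i)) / real (card (Y i))"

definition lim_dens :: "(nat \<Rightarrow> 'b set) \<Rightarrow> real" where
  "lim_dens A = Lim \<omega> (dens A)"

lemma card_pos: "0 < real (card (Y i))"
  using fin ne by (simp add: card_gt_0_iff)

lemma dens_bounds: "dens A i \<in> {0..1}"
  using card_pos[of i] card_mono[OF fin, of "A i \<inter> Y i" i] by (auto simp: dens_def field_simps)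

lemma dens_tendsto: "(dens A \<longlongrightarrow> lim_dens A) \<omega>"
proof -
  obtain L where "(dens A \<longlongrightarrow> L) \<omega>"
    using bounded_tendsto_exists[of "dens A" 0 1] dens_bounds by blast
  then show ?thesis unfolding lim_dens_def using tendsto_Lim[OF nontrivial] by metis
qed

lemma dens_tendsto_unique: "(dens A \<longlongrightarrow> r) \<omega> \<Longrightarrow> lim_dens A = r"
  using tendsto_unique[OF nontrivial dens_tendsto] .

lemma lim_dens_nonneg: "0 \<le> lim_dens A"
  by (rule tendsto_lowerbound[OF dens_tendsto _ nontrivial]) (use dens_bounds in auto)

lemma lim_dens_mono: "internal A \<subseteq> internal B \<Longrightarrow> lim_dens A \<le> lim_dens B"
  unfolding internal_mono_iff
proof (rule tendsto_le[OF nontrivial dens_tendsto dens_tendsto])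
  assume "\<forall>\<^sub>F i in \<omega>. A i \<inter> Y i \<subseteq> B i"
  then show "\<forall>\<^sub>F i in \<omega>. dens A i \<le> dens B i"
  proof eventually_elim
    case (elim i)
    have "card (A i \<inter> Y i) \<le> card (B i \<inter> Y i)"
      using elim fin by (intro card_mono) auto
    then show ?case by (simp add: dens_def divide_right_mono)
  qed
qed

lemma lim_dens_cong: "internal A = internal B \<Longrightarrow> lim_dens A = lim_dens B"
  using lim_dens_mono[of A B] lim_dens_mono[of B A] by auto

lemma lim_dens_Un_Int:
  "lim_dens (\<lambda>i. A i \<union> B i) + lim_dens (\<lambda>i. A i \<inter> B i) = lim_dens A + lim_dens B"
proof -
  have "dens (\<lambda>i. A i \<union> B i) i + dens (\<lambda>i. A i \<inter> B i) i = dens A i + dens B i" for i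
    using card_Un_Int[of "A i \<inter> Y i" "B i \<inter> Y i"] fin[of i]
    by (simp add: dens_def Int_Un_distrib2 Int_ac Int_Un_distrib flip: add_divide_distrib of_nat_add)
  then have "((\<lambda>i. dens A i + dens B i) \<longlongrightarrow>
      lim_dens (\<lambda>i. A i \<union> B i) + lim_dens (\<lambda>i. A i \<inter> B i)) \<omega>"
    using tendsto_add[OF dens_tendsto[of "\<lambda>i. A i \<union> B i"] dens_tendsto[of "\<lambda>i. A i \<inter> B i"]] by simp
  then show ?thesis
    using tendsto_unique[OF nontrivial] tendsto_add[OF dens_tendsto[of A] dens_tendsto[of B]]
    by blast
qed

lemma lim_dens_empty: "lim_dens (\<lambda>i. {}) = 0"
  by (rule dens_tendsto_unique) (simp add: dens_def[abs_def])

lemma lim_dens_Y: "lim_dens Y = 1"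
proof (rule dens_tendsto_unique)
  have "dens Y i = 1" for i using card_pos[of i] by (simp add: dens_def)
  then have "dens Y = (\<lambda>i. 1)" by auto
  then show "(dens Y \<longlongrightarrow> 1) \<omega>" by simp
qed

lemma lim_dens_Un_le: "lim_dens (\<lambda>i. A i \<union> B i) \<le> lim_dens A + lim_dens B"
  using lim_dens_Un_Int[of A B] lim_dens_nonneg[of "\<lambda>i. A i \<inter> B i"] by simp

lemma lim_dens_Diff_Int: "lim_dens A = lim_dens (\<lambda>i. A i - B i) + lim_dens (\<lambda>i. A i \<inter> B i)"
proof -
  have "lim_dens (\<lambda>i. (A i - B i) \<union> (A i \<inter> B i)) = lim_dens A"
    by (rule lim_dens_cong) (simp add: Un_Diff_Int)
  moreover have "lim_dens (\<lambda>i. (A i - B i) \<inter> (A i \<inter> B i)) = 0"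
    by (rule trans[OF lim_dens_cong lim_dens_empty], rule internal_cong) auto
  ultimately show ?thesis using lim_dens_Un_Int[of "\<lambda>i. A i - B i" "\<lambda>i. A i \<inter> B i"] by simp
qed

lemma abs_lim_dens_diff_le:
  "\<bar>lim_dens A - lim_dens B\<bar> \<le> lim_dens (\<lambda>i. sym_diff (A i) (B i))"
proof -
  have "lim_dens A - lim_dens B \<le> lim_dens (\<lambda>i. sym_diff (A i) (B i))" for A B
  proof -
    have "lim_dens A \<le> lim_dens (\<lambda>i. B i \<union> sym_diff (A i) (B i))"
      by (rule lim_dens_mono) (auto simp: internal_Un internal_sym_diff internal_Diff)
    also have "\<dots> \<le> lim_dens B + lim_dens (\<lambda>i. sym_diff (A i) (B i))"
      by (rule lim_dens_Un_le)
    finally show ?thesis by simp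
  qed
  from this[of A B] this[of B A] show ?thesis
    by (simp add: Un_commute abs_le_iff)
qed

lemma lim_dens_UN_atMost_le: "lim_dens (\<lambda>i. \<Union>j\<le>(m::nat). A j i) \<le> (\<Sum>j\<le>m. lim_dens (A j))"
proof (induction m)
  case (Suc m)
  show ?case
    using lim_dens_Un_le[of "A (Suc m)" "\<lambda>i. \<Union>j\<le>m. A j i"] Suc by (simp add: atMost_Suc)
qed simp

lemma internal_sets_eq: "internal_sets \<omega> Y = range internal"
proof -
  have "internal A \<in> internal_sets \<omega> Y" for A
    using internal_cong[of A "\<lambda>i. A i \<inter> Y i"] by (auto simp: internal_sets_def)
  then show ?thesis by (auto simp: internal_sets_def)
qed

text \<open>The definite description is meaningful because sequences with the same internal set have
  the same limit density, by \<open>lim_dens_cong\<close>.\<close>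

lemma internal_measure_eq: "internal_measure \<omega> Y (internal A) = lim_dens A"
  unfolding internal_measure_def
proof (rule the_equality)
  have "dens A = (\<lambda>i. real (card (A i \<inter> Y i)) / real (card (Y i)))" by (auto simp: dens_def)
  then show "\<exists>B. (\<forall>i. B i \<subseteq> Y i) \<and> internal A = internal B \<and>
      ((\<lambda>i. real (card (B i)) / real (card (Y i))) \<longlongrightarrow> lim_dens A) \<omega>"
    using dens_tendsto[of A] internal_cong[of A "\<lambda>i. A i \<inter> Y i"]
    by (intro exI[of _ "\<lambda>i. A i \<inter> Y i"]) auto
next
  fix r assume "\<exists>B. (\<forall>i. B i \<subseteq> Y i) \<and> internal A = internal B \<and>
      ((\<lambda>i. real (card (B i)) / real (card (Y i))) \<longlongrightarrow> r) \<omega>"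
  then obtain B where B: "\<And>i. B i \<subseteq> Y i" "internal A = internal B"
      "((\<lambda>i. real (card (B i)) / real (card (Y i))) \<longlongrightarrow> r) \<omega>" by blast
  have "(\<lambda>i. real (card (B i)) / real (card (Y i))) = dens B"
    using B(1) by (auto simp: dens_def Int_absorb2)
  then show "r = lim_dens A"
    using B dens_tendsto_unique lim_dens_cong by metis
qed

lemma null_iff: "null N \<longleftrightarrow> N \<subseteq> \<Omega> \<and> (\<forall>\<epsilon>>0. \<exists>A. N \<subseteq> internal A \<and> lim_dens A \<le> \<epsilon>)"
  by (simp add: ultra_null_def internal_sets_eq internal_measure_eq)

lemma null_subset: "null N \<Longrightarrow> N' \<subseteq> N \<Longrightarrow> null N'"
  unfolding null_iff by (meson order_trans)

lemma null_empty: "null {}"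
  unfolding null_iff using lim_dens_empty by (metis empty_subsetI less_imp_le)

lemma null_internal_iff: "null (internal A) \<longleftrightarrow> lim_dens A = 0"
proof
  assume "null (internal A)"
  then have "lim_dens A \<le> 0 + \<epsilon>" if "\<epsilon> > 0" for \<epsilon>
    using that lim_dens_mono unfolding null_iff by (metis add_0 order_trans)
  then have "lim_dens A \<le> 0" by (rule field_le_epsilon)
  with lim_dens_nonneg[of A] show "lim_dens A = 0" by simp
next
  assume "lim_dens A = 0"
  then show "null (internal A)"
    unfolding null_iff using internal_subset by (metis less_imp_le order_refl)
qed

text \<open>Countable saturation: the cut-off index in the union grows with \<open>i\<close>, which uses that
  \<open>\<omega>\<close> is nonprincipal.\<close>

lemma countable_internal_cover:
  fixes A :: "nat \<Rightarrow> nat \<Rightarrow> 'b set"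
  assumes bound: "\<And>m. lim_dens (\<lambda>i. \<Union>j\<le>m. A j i) \<le> r"
  obtains B where "\<And>m. internal (A m) \<subseteq> internal B" "lim_dens B \<le> r"
proof
  define a where "a m i = (\<Union>j\<le>m. A j i)" for m i
  \<comment> \<open>The admissible cut-offs at index \<open>i\<close>: bounded by \<open>i\<close>
    so that there is a largest one, and with density already within \<open>1 / Suc m\<close> of its
    limit. Each fixed \<open>m\<close> is admissible for almost all \<open>i\<close>. Since the
    \<open>a m i\<close> increase with \<open>m\<close>, \<open>B i\<close> is the partial union at
    the largest admissible cut-off.\<close>
  define S where "S i = {m. m \<le> i \<and> dens (a m) i \<le> lim_dens (a m) + 1 / Suc m}" for i
  define B where "B i = (\<Union>m\<in>S i. a m i)" for i
  have a_mono: "m \<le> m' \<Longrightarrow> a m i \<subseteq> a m' i" for m m' i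
    unfolding a_def by (intro UN_mono) auto
  have evS: "\<forall>\<^sub>F i in \<omega>. m \<in> S i" for m
  proof -
    have "\<forall>\<^sub>F i in \<omega>. dens (a m) i < lim_dens (a m) + 1 / Suc m"
      by (rule order_tendstoD(2)[OF dens_tendsto]) simp
    with eventually_ge[of m] show ?thesis
      by eventually_elim (simp add: S_def)
  qed
  show "internal (A m) \<subseteq> internal B" for m
    unfolding internal_mono_iff
    using evS[of m] by eventually_elim (auto simp: B_def a_def)
  have "lim_dens B \<le> r + 1 / Suc m" for m
  proof (rule tendsto_upperbound[OF dens_tendsto _ nontrivial])
    show "\<forall>\<^sub>F i in \<omega>. dens B i \<le> r + 1 / Suc m"
      using evS[of m]
    proof eventually_elim
      case (elim i)
      have finS: "finite (S i)" by (rule finite_subset[of _ "{..i}"]) (auto simp: S_def)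
      define M where "M = Max (S i)"
      have M: "M \<in> S i" unfolding M_def using elim finS by (intro Max_in) auto
      have "m \<le> M" using elim finS by (simp add: M_def)
      have "a m' i \<subseteq> a M i" if "m' \<in> S i" for m'
        using that finS by (intro a_mono) (simp add: M_def)
      then have "B i = a M i" using M by (auto simp: B_def)
      then have "dens B i = dens (a M) i" by (simp add: dens_def)
      also have "\<dots> \<le> lim_dens (a M) + 1 / Suc M" using M by (simp add: S_def)
      also have "\<dots> \<le> r + 1 / Suc m"
        using bound[of M] \<open>m \<le> M\<close> by (intro add_mono) (simp_all add: a_def[abs_def] frac_le)
      finally show ?case .
    qed
  qed
  then have "lim_dens B - r \<le> 1 / Suc m" for m by (simp add: algebra_simps)
  then have "lim_dens B - r \<le> 0"
    by (intro LIMSEQ_le_const[OF LIMSEQ_Suc[OF lim_1_over_n]]) (auto intro!: exI[of _ 0])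
  then show "lim_dens B \<le> r" by simp
qed

lemma null_UN:
  assumes "\<And>m::nat. null (N m)"
  shows "null (\<Union>m. N m)"
  unfolding null_iff
proof (intro conjI allI impI)
  show "(\<Union>m. N m) \<subseteq> \<Omega>" using assms by (auto simp: null_iff)
  fix \<epsilon> :: real assume "\<epsilon> > 0"
  have "\<forall>m. \<exists>A. N m \<subseteq> internal A \<and> lim_dens A \<le> \<epsilon> * (1/2) ^ Suc m"
    using assms \<open>\<epsilon> > 0\<close> unfolding null_iff by (metis mult_pos_pos zero_less_power half_gt_zero zero_less_one)
  then obtain A where A: "\<And>m. N m \<subseteq> internal (A m)" "\<And>m. lim_dens (A m) \<le> \<epsilon> * (1/2) ^ Suc m"
    by metis
  have "lim_dens (\<lambda>i. \<Union>j\<le>m. A j i) \<le> \<epsilon>" for m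
  proof -
    have "lim_dens (\<lambda>i. \<Union>j\<le>m. A j i) \<le> (\<Sum>j\<le>m. \<epsilon> * (1/2) ^ Suc j)"
      by (rule order_trans[OF lim_dens_UN_atMost_le sum_mono]) (rule A)
    also have "\<dots> = \<epsilon> * (\<Sum>j\<le>m. (1/2) ^ Suc j)" by (simp add: sum_distrib_left)
    also have "(\<Sum>j\<le>m. (1/2::real) ^ Suc j) = 1 - (1/2) ^ Suc m"
      by (induction m) (auto simp: field_simps)
    also have "\<epsilon> * (1 - (1/2) ^ Suc m) \<le> \<epsilon> * 1"
      using \<open>\<epsilon> > 0\<close> by (intro mult_left_mono) auto
    finally show ?thesis by simp
  qed
  then obtain B where "\<And>m. internal (A m) \<subseteq> internal B" "lim_dens B \<le> \<epsilon>"
    using countable_internal_cover by metis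
  then show "\<exists>A. (\<Union>m. N m) \<subseteq> internal A \<and> lim_dens A \<le> \<epsilon>" using A(1) by blast
qed

lemma null_Un: "null N \<Longrightarrow> null N' \<Longrightarrow> null (N \<union> N')"
proof -
  assume "null N" "null N'"
  then have "null (\<Union>m::nat. if m = 0 then N else N')" by (intro null_UN) simp
  moreover have "N \<union> N' \<subseteq> (\<Union>m::nat. if m = 0 then N else N')" by (auto split: if_splits)
  ultimately show ?thesis by (rule null_subset)
qed

section \<open>The sigma-algebra of measurable sets and countable additivity\<close>

lemma ultra_sets_iff: "S \<in> ultra_sets \<omega> Y \<longleftrightarrow> S \<subseteq> \<Omega> \<and> (\<exists>A. null (sym_diff S (internal A)))"
  by (simp add: ultra_sets_def internal_sets_eq)

lemma lim_dens_eq_of_null: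
  assumes "null (sym_diff S (internal A))" "null (sym_diff S (internal B))"
  shows "lim_dens A = lim_dens B"
proof -
  have "null (internal (\<lambda>i. sym_diff (A i) (B i)))"
    unfolding internal_sym_diff by (rule null_subset[OF null_Un[OF assms]]) auto
  then have "lim_dens (\<lambda>i. sym_diff (A i) (B i)) = 0" by (simp add: null_internal_iff)
  with abs_lim_dens_diff_le[of A B] show ?thesis by simp
qed

lemma ultra_value_eq:
  assumes "null (sym_diff S (internal A))"
  shows "ultra_value \<omega> Y S = lim_dens A"
  unfolding ultra_value_def
proof (rule the_equality)
  show "\<exists>P\<in>internal_sets \<omega> Y. null (sym_diff S P) \<and> lim_dens A = internal_measure \<omega> Y P"
    unfolding internal_sets_eq using assms internal_measure_eq[of A]
    by (intro bexI[of _ "internal A"]) simp_all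
next
  fix r assume "\<exists>P\<in>internal_sets \<omega> Y. null (sym_diff S P) \<and> r = internal_measure \<omega> Y P"
  then obtain B where "null (sym_diff S (internal B))" "r = lim_dens B"
    unfolding internal_sets_eq by (auto simp: internal_measure_eq)
  then show "r = lim_dens A" using lim_dens_eq_of_null[OF assms] by simp
qed

lemma ultra_value_internal: "ultra_value \<omega> Y (internal A) = lim_dens A"
  by (rule ultra_value_eq) (simp add: null_empty)

text \<open>A countable union of internal sets need not be internal. Saturation supplies an internal
  \<open>B\<close> above it whose density is the limit \<open>r\<close> of those of the partial
  unions. The excess of \<open>B\<close> over the union is contained in \<open>B\<close> minus each
  partial union, which has density \<open>r - d m\<close>, so it is null.\<close>

lemma countable_union_approx:
  fixes A :: "nat \<Rightarrow> nat \<Rightarrow> 'b set"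
  assumes A: "\<And>m. null (sym_diff (S m) (internal (A m)))"
  obtains B where "null (sym_diff (\<Union>m. S m) (internal B))"
    "(\<lambda>m. lim_dens (\<lambda>i. \<Union>j\<le>m. A j i)) \<longlonglongrightarrow> lim_dens B"
proof -
  define d where "d m = lim_dens (\<lambda>i. \<Union>j\<le>m. A j i)" for m
  have d_mono: "incseq d"
    unfolding d_def incseq_def by (intro allI impI lim_dens_mono) (simp add: internal_UN_atMost, force)
  have d_le: "d m \<le> 1" for m
    using lim_dens_mono[of _ Y] internal_subset by (simp add: d_def internal_Y lim_dens_Y)
  obtain r where r: "d \<longlonglongrightarrow> r" "\<And>m. d m \<le> r"
    using incseq_convergent[OF d_mono, of 1] d_le by auto
  obtain B where B: "\<And>m. internal (A m) \<subseteq> internal B" "lim_dens B \<le> r"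
    using countable_internal_cover[of A r] r(2) by (auto simp: d_def)
  have dB: "d m \<le> lim_dens B" for m
    unfolding d_def by (rule lim_dens_mono) (use B in \<open>auto simp: internal_UN_atMost\<close>)
  then have "r \<le> lim_dens B" by (intro LIMSEQ_le_const2[OF r(1)]) auto
  with B have rB: "r = lim_dens B" by simp
  have "null (internal B - (\<Union>m. internal (A m)))"
    unfolding null_iff
  proof (intro conjI allI impI)
    show "internal B - (\<Union>m. internal (A m)) \<subseteq> \<Omega>" using internal_subset by auto
    fix \<epsilon> :: real assume "\<epsilon> > 0"
    then have "\<forall>\<^sub>F m in sequentially. d m > r - \<epsilon>" by (intro order_tendstoD(1)[OF r(1)]) simp
    then obtain m where m: "d m > r - \<epsilon>" by (auto simp: eventually_sequentially)
    define U where "U i = (\<Union>j\<le>m. A j i)" for i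
    have intU: "internal U = (\<Union>j\<le>m. internal (A j))"
      unfolding U_def[abs_def] by (rule internal_UN_atMost)
    have "lim_dens (\<lambda>i. B i \<inter> U i) = lim_dens U"
      by (rule lim_dens_cong) (use B(1) in \<open>auto simp: internal_Int intU\<close>)
    then have "lim_dens (\<lambda>i. B i - U i) = lim_dens B - d m"
      using lim_dens_Diff_Int[of B U] by (simp add: d_def U_def[abs_def])
    with m rB have "lim_dens (\<lambda>i. B i - U i) \<le> \<epsilon>" by simp
    moreover have "internal B - (\<Union>m. internal (A m)) \<subseteq> internal (\<lambda>i. B i - U i)"
      by (auto simp: internal_Diff intU)
    ultimately show "\<exists>A'. internal B - (\<Union>m. internal (A m)) \<subseteq> internal A' \<and> lim_dens A' \<le> \<epsilon>"
      by blast
  qed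
  then have "null ((\<Union>m. sym_diff (S m) (internal (A m))) \<union> (internal B - (\<Union>m. internal (A m))))"
    by (intro null_Un null_UN A)
  then have "null (sym_diff (\<Union>m. S m) (internal B))"
    by (rule null_subset) (use B(1) in blast)
  with that r(1) rB show thesis by (simp add: d_def[abs_def])
qed

lemma sigma_algebra_ultra_sets: "sigma_algebra \<Omega> (ultra_sets \<omega> Y)"
  unfolding sigma_algebra_iff2
proof (intro conjI ballI allI impI)
  show "ultra_sets \<omega> Y \<subseteq> Pow \<Omega>" by (auto simp: ultra_sets_iff)
  show "{} \<in> ultra_sets \<omega> Y"
    by (auto simp: ultra_sets_iff intro!: exI[of _ "\<lambda>i. {}"] simp: internal_empty null_empty)
next
  fix S assume "S \<in> ultra_sets \<omega> Y"
  then obtain A where A: "S \<subseteq> \<Omega>" "null (sym_diff S (internal A))" by (auto simp: ultra_sets_iff)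
  have "null (sym_diff (\<Omega> - S) (internal (\<lambda>i. - A i)))"
    by (rule null_subset[OF A(2)]) (use A(1) in \<open>auto simp: internal_compl\<close>)
  then show "\<Omega> - S \<in> ultra_sets \<omega> Y" by (auto simp: ultra_sets_iff)
next
  fix S :: "nat \<Rightarrow> _" assume "range S \<subseteq> ultra_sets \<omega> Y"
  then have S: "\<And>m. S m \<subseteq> \<Omega>" "\<And>m. \<exists>A. null (sym_diff (S m) (internal A))"
    unfolding ultra_sets_iff[symmetric] by (auto simp: ultra_sets_iff image_subset_iff)
  then obtain A where "\<And>m. null (sym_diff (S m) (internal (A m)))" by metis
  then show "\<Union>(range S) \<in> ultra_sets \<omega> Y"
    using S(1) countable_union_approx[of S A] unfolding ultra_sets_iff by (metis UN_least)
qed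

lemma ultra_value_sums:
  fixes S :: "nat \<Rightarrow> (nat \<Rightarrow> 'b) set set"
  assumes S: "\<And>m. S m \<in> ultra_sets \<omega> Y" and disj: "disjoint_family S"
  shows "(\<lambda>m. ultra_value \<omega> Y (S m)) sums ultra_value \<omega> Y (\<Union>m. S m)"
proof -
  have "\<And>m. \<exists>A. null (sym_diff (S m) (internal A))" using S by (auto simp: ultra_sets_iff)
  then obtain A where A: "\<And>m. null (sym_diff (S m) (internal (A m)))" by metis
  then obtain B where B: "null (sym_diff (\<Union>m. S m) (internal B))"
    "(\<lambda>m. lim_dens (\<lambda>i. \<Union>j\<le>m. A j i)) \<longlonglongrightarrow> lim_dens B"
    using countable_union_approx by blast
  have "lim_dens (\<lambda>i. \<Union>j\<le>m. A j i) = (\<Sum>j\<le>m. ultra_value \<omega> Y (S j))" for m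
  proof (induction m)
    case 0
    show ?case by (simp add: ultra_value_eq[OF A])
  next
    case (Suc m)
    \<comment> \<open>The \<open>S m\<close> are disjoint, but their approximants only up to null
      sets: a point in two approximants cannot lie in both of the corresponding sets, so it belongs
      to one of the error sets.\<close>
    have "null (internal (\<lambda>i. A (Suc m) i \<inter> (\<Union>j\<le>m. A j i)))"
    proof (rule null_subset[OF null_UN[OF A]])
      have "S (Suc m) \<inter> S j = {}" if "j \<le> m" for j
        using disj that by (auto simp: disjoint_family_on_def)
      then show "internal (\<lambda>i. A (Suc m) i \<inter> (\<Union>j\<le>m. A j i)) \<subseteq> (\<Union>m. sym_diff (S m) (internal (A m)))"
        unfolding internal_Int internal_UN_atMost by blast
    qed
    then have "lim_dens (\<lambda>i. A (Suc m) i \<inter> (\<Union>j\<le>m. A j i)) = 0" by (simp add: null_internal_iff)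
    then show ?case
      using lim_dens_Un_Int[of "A (Suc m)" "\<lambda>i. \<Union>j\<le>m. A j i"] Suc ultra_value_eq[OF A, of "Suc m"]
      by (simp add: atMost_Suc)
  qed
  with B(2) show ?thesis
    unfolding sums_def_le ultra_value_eq[OF B(1)] by simp
qed

lemma measure_space_ultra:
  "measure_space \<Omega> (ultra_sets \<omega> Y) (\<lambda>B. ennreal (ultra_value \<omega> Y B))"
  unfolding measure_space_def
proof (intro conjI sigma_algebra_ultra_sets)
  have "ultra_value \<omega> Y {} = 0"
    using ultra_value_internal[of "\<lambda>i. {}"] by (simp add: internal_empty lim_dens_empty)
  then show "positive (ultra_sets \<omega> Y) (\<lambda>B. ennreal (ultra_value \<omega> Y B))"
    by (simp add: positive_def)
  show "countably_additive (ultra_sets \<omega> Y) (\<lambda>B. ennreal (ultra_value \<omega> Y B))"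
  proof (rule countably_additiveI)
    fix S :: "nat \<Rightarrow> _" assume S: "range S \<subseteq> ultra_sets \<omega> Y" "disjoint_family S"
    then have sums: "(\<lambda>m. ultra_value \<omega> Y (S m)) sums ultra_value \<omega> Y (\<Union>m. S m)"
      by (intro ultra_value_sums) auto
    have "0 \<le> ultra_value \<omega> Y (S m)" for m
    proof -
      have "S m \<in> ultra_sets \<omega> Y" using S by auto
      then obtain A where "null (sym_diff (S m) (internal A))" by (auto simp: ultra_sets_iff)
      from ultra_value_eq[OF this] lim_dens_nonneg show ?thesis by simp
    qed
    with sums show "(\<Sum>m. ennreal (ultra_value \<omega> Y (S m))) = ennreal (ultra_value \<omega> Y (\<Union>m. S m))"
      by (subst suminf_ennreal2) (auto simp: sums_iff)
  qed
qed

abbreviation "LM \<equiv> ultra_measure \<omega> Y"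

lemma space_LM[simp]: "space LM = \<Omega>"
  unfolding ultra_measure_def
  by (rule space_measure_of) (auto simp: ultra_sets_iff)

lemma sets_LM: "sets LM = ultra_sets \<omega> Y"
  unfolding ultra_measure_def
  by (rule sigma_algebra.sets_measure_of_eq[OF sigma_algebra_ultra_sets])

lemma emeasure_LM: "S \<in> sets LM \<Longrightarrow> emeasure LM S = ennreal (ultra_value \<omega> Y S)"
  using measure_space_ultra unfolding sets_LM unfolding ultra_measure_def measure_space_def
  by (intro emeasure_measure_of_sigma) auto

lemma internal_in_sets[measurable]: "internal A \<in> sets LM"
  unfolding sets_LM ultra_sets_iff using internal_subset[of A] null_empty by (auto intro!: exI[of _ A])

lemma emeasure_internal: "emeasure LM (internal A) = ennreal (lim_dens A)"
  by (simp add: emeasure_LM ultra_value_internal)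

lemma measure_internal: "measure LM (internal A) = lim_dens A"
  by (simp add: measure_def emeasure_internal lim_dens_nonneg)

lemma prob_space_LM: "prob_space LM"
proof
  show "emeasure LM (space LM) = 1"
    using emeasure_internal[of Y] by (simp add: internal_Y lim_dens_Y)
qed

text \<open>Together with \<open>null_subset\<close> this says that the Loeb measure is complete.
  Errors can therefore be discarded by inclusion alone, without proving them measurable.\<close>

lemma null_sets_LM_iff: "N \<in> null_sets LM \<longleftrightarrow> null N"
proof
  assume N: "N \<in> null_sets LM"
  then have Ns: "N \<in> sets LM" and N0: "emeasure LM N = 0" by auto
  obtain A where A: "N \<subseteq> \<Omega>" "null (sym_diff N (internal A))"
    using Ns by (auto simp: sets_LM ultra_sets_iff)
  have "lim_dens A = 0"
    using emeasure_LM[OF Ns] N0 ultra_value_eq[OF A(2)] lim_dens_nonneg[of A] by simp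
  then have "null (internal A)" by (simp add: null_internal_iff)
  then show "null N" by (rule null_subset[OF null_Un[OF A(2)]]) auto
next
  assume N: "null N"
  then have *: "null (sym_diff N (internal (\<lambda>i. {})))" by (simp add: internal_empty)
  then have "N \<in> sets LM" using N by (auto simp: sets_LM ultra_sets_iff null_iff)
  with emeasure_LM[OF this] ultra_value_eq[OF *] show "N \<in> null_sets LM"
    by (auto simp: lim_dens_empty)
qed

lemma measure_eq_lim_dens:
  assumes "S \<subseteq> \<Omega>" "null (sym_diff S (internal A))"
  shows "measure LM S = lim_dens A"
proof -
  have "S \<in> sets LM" using assms by (auto simp: sets_LM ultra_sets_iff)
  then show ?thesis
    using ultra_value_eq[OF assms(2)] by (simp add: measure_def emeasure_LM lim_dens_nonneg)
qed

end

text \<open>The assumption \<open>uniform\<close> says that \<open>f\<close> carries the uniform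
  distribution on \<open>Y i\<close> to that on \<open>Z i\<close>, multiplied out to an identity of
  natural numbers. This is what makes the induced map preserve the Loeb measure.\<close>

locale ultra_map_space = src: ultra_space \<omega> Y + tgt: ultra_space \<omega> Z
  for \<omega> and Y :: "nat \<Rightarrow> 'b set" and Z :: "nat \<Rightarrow> 'c set" +
  fixes f :: "'b \<Rightarrow> 'c"
  assumes maps: "y \<in> Y i \<Longrightarrow> f y \<in> Z i"
    and uniform: "card {y \<in> Y i. f y \<in> D} * card (Z i) = card (D \<inter> Z i) * card (Y i)"
begin

abbreviation "T \<equiv> ultra_map \<omega> Z f"

lemma ultra_map_cls:
  assumes "\<And>i. p i \<in> Y i"
  shows "T (src.cls p) = tgt.cls (\<lambda>i. f (p i))"
proof (intro equalityI subsetI)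
  fix q assume "q \<in> T (src.cls p)"
  then obtain p' where "\<forall>i. q i \<in> Z i" "\<forall>\<^sub>F i in \<omega>. p i = p' i" "\<forall>\<^sub>F i in \<omega>. q i = f (p' i)"
    by (auto simp: ultra_map_def src.cls_def)
  then show "q \<in> tgt.cls (\<lambda>i. f (p i))"
    by (auto simp: tgt.cls_def elim: eventually_elim2)
next
  fix q assume "q \<in> tgt.cls (\<lambda>i. f (p i))"
  then show "q \<in> T (src.cls p)"
    using assms by (auto simp: ultra_map_def src.cls_def tgt.cls_def eq_commute intro!: exI[of _ p])
qed

lemma ultra_map_in: "c \<in> src.\<Omega> \<Longrightarrow> T c \<in> tgt.\<Omega>"
  by (erule src.ultraproductE) (simp add: ultra_map_cls maps)

lemma vimage_internal: "T -` tgt.internal D \<inter> src.\<Omega> = src.internal (\<lambda>i. f -` D i)"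
  by (rule sym, rule src.internal_eqI) (auto simp: ultra_map_cls tgt.cls_internal_iff maps)

lemma lim_dens_vimage: "src.lim_dens (\<lambda>i. f -` D i) = tgt.lim_dens D"
proof -
  have "src.dens (\<lambda>i. f -` D i) i = tgt.dens D i" for i
  proof -
    have "f -` D i \<inter> Y i = {y \<in> Y i. f y \<in> D i}" by auto
    moreover have "real (card {y \<in> Y i. f y \<in> D i}) * real (card (Z i)) =
        real (card (D i \<inter> Z i)) * real (card (Y i))"
      unfolding of_nat_mult[symmetric] by (simp only: uniform[of i "D i"])
    ultimately show ?thesis
      using src.card_pos[of i] tgt.card_pos[of i] by (simp add: src.dens_def tgt.dens_def field_simps)
  qed
  then have "src.dens (\<lambda>i. f -` D i) = tgt.dens D" by (rule ext)
  then show ?thesis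
    using tgt.dens_tendsto[of D] by (intro src.dens_tendsto_unique) simp
qed

lemma null_vimage: "tgt.null N \<Longrightarrow> src.null (T -` N \<inter> src.\<Omega>)"
  unfolding src.null_iff
proof (intro conjI allI impI)
  fix \<epsilon> :: real assume "tgt.null N" "\<epsilon> > 0"
  then obtain D where "N \<subseteq> tgt.internal D" "tgt.lim_dens D \<le> \<epsilon>" by (auto simp: tgt.null_iff)
  then have "T -` N \<inter> src.\<Omega> \<subseteq> src.internal (\<lambda>i. f -` D i)" "src.lim_dens (\<lambda>i. f -` D i) \<le> \<epsilon>"
    by (auto simp: lim_dens_vimage vimage_internal[symmetric])
  then show "\<exists>A. T -` N \<inter> src.\<Omega> \<subseteq> src.internal A \<and> src.lim_dens A \<le> \<epsilon>" by blast
qed simp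

text \<open>Stronger than measurability: it names the approximant of the preimage, and so keeps
  track of the coordinates on which that approximant depends.\<close>

lemma vimage_approx:
  assumes "tgt.null (sym_diff S (tgt.internal D))"
  shows "src.null (sym_diff (T -` S \<inter> src.\<Omega>) (src.internal (\<lambda>i. f -` D i)))"
  by (rule src.null_subset[OF null_vimage[OF assms]])
    (unfold vimage_internal[symmetric], blast)

lemma measurable_ultra_map[measurable]: "T \<in> src.LM \<rightarrow>\<^sub>M tgt.LM"
proof (rule measurableI)
  fix S assume "S \<in> sets tgt.LM"
  then obtain D where "tgt.null (sym_diff S (tgt.internal D))"
    by (auto simp: tgt.sets_LM tgt.ultra_sets_iff)
  from vimage_approx[OF this] show "T -` S \<inter> space src.LM \<in> sets src.LM"
    unfolding src.sets_LM src.ultra_sets_iff by auto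
qed (simp add: ultra_map_in)

end

section \<open>Resampling coordinates of a finite power\<close>

definition pull :: "'j set \<Rightarrow> ('j \<Rightarrow> 'i) \<Rightarrow> ('i \<Rightarrow> 'v) \<Rightarrow> 'j \<Rightarrow> 'v" where
  "pull J s x = (\<lambda>j\<in>J. x (s j))"

definition glue :: "'i set \<Rightarrow> 'j set \<Rightarrow> ('j \<Rightarrow> 'i) \<Rightarrow> ('i \<Rightarrow> 'v) \<Rightarrow> ('j \<Rightarrow> 'v) \<Rightarrow> 'i \<Rightarrow> 'v" where
  "glue I A s x z = (\<lambda>i\<in>I. if i \<in> s ` A then z (inv_into A s i) else x i)"

definition depends_on :: "'j set \<Rightarrow> 'v set \<Rightarrow> 'j set \<Rightarrow> ('j \<Rightarrow> 'v) set \<Rightarrow> bool" where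
  "depends_on J V A a \<longleftrightarrow> (\<forall>x\<in>J \<rightarrow>\<^sub>E V. \<forall>y\<in>J \<rightarrow>\<^sub>E V. (\<forall>j\<in>A. x j = y j) \<longrightarrow> (x \<in> a \<longleftrightarrow> y \<in> a))"

lemma pull_in: "s ` J \<subseteq> I \<Longrightarrow> x \<in> I \<rightarrow>\<^sub>E V \<Longrightarrow> pull J s x \<in> J \<rightarrow>\<^sub>E V"
  by (auto simp: pull_def PiE_iff)

lemma glue_in:
  "A \<subseteq> J \<Longrightarrow> x \<in> I \<rightarrow>\<^sub>E V \<Longrightarrow> z \<in> J \<rightarrow>\<^sub>E V \<Longrightarrow> glue I A s x z \<in> I \<rightarrow>\<^sub>E V"
  by (auto simp: glue_def PiE_iff inv_into_into subset_iff)

lemma glue_image: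
  "inj_on s A \<Longrightarrow> s ` A \<subseteq> I \<Longrightarrow> j \<in> A \<Longrightarrow> glue I A s x z (s j) = z j"
  by (auto simp: glue_def)

text \<open>Exchanging the coordinates in \<open>A\<close> with those in \<open>s ` A\<close> is an involution of
  \<open>V\<^sup>I \<times> V\<^sup>J\<close>, hence \<open>glue\<close> of independent uniform points is uniform.\<close>

lemma card_glue:
  fixes V :: "'v set" and I :: "'i set" and J :: "'j set"
  assumes fin: "finite V" "finite I" "finite J" and A: "A \<subseteq> J" "inj_on s A" "s ` A \<subseteq> I"
  shows "card {(x, z) \<in> (I \<rightarrow>\<^sub>E V) \<times> (J \<rightarrow>\<^sub>E V). \<phi> (glue I A s x z)} =
    card {x \<in> I \<rightarrow>\<^sub>E V. \<phi> x} * card (J \<rightarrow>\<^sub>E V)"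
proof -
  define sw where "sw = (\<lambda>(x :: 'i \<Rightarrow> 'v, z :: 'j \<Rightarrow> 'v). (glue I A s x z, \<lambda>j\<in>J. if j \<in> A then x (s j) else z j))"
  let ?PR = "(I \<rightarrow>\<^sub>E V) \<times> (J \<rightarrow>\<^sub>E V)"
  have sw_in: "sw ` ?PR \<subseteq> ?PR"
  proof (rule image_subsetI)
    fix xz assume "xz \<in> ?PR"
    then obtain x z where xz: "xz = (x, z)" "x \<in> I \<rightarrow>\<^sub>E V" "z \<in> J \<rightarrow>\<^sub>E V" by blast
    have "(\<lambda>j\<in>J. if j \<in> A then x (s j) else z j) \<in> J \<rightarrow>\<^sub>E V"
      using A xz by (auto simp: PiE_iff)
    with glue_in[OF A(1) xz(2,3)] show "sw xz \<in> ?PR" by (simp add: sw_def xz(1))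
  qed
  have sw_sw: "sw (sw xz) = xz" if PR: "xz \<in> ?PR" for xz
  proof -
    obtain x z where xz: "xz = (x, z)" "x \<in> I \<rightarrow>\<^sub>E V" "z \<in> J \<rightarrow>\<^sub>E V" using PR by blast
    have "glue I A s (glue I A s x z) (\<lambda>j\<in>J. if j \<in> A then x (s j) else z j) = x"
    proof
      fix i show "glue I A s (glue I A s x z) (\<lambda>j\<in>J. if j \<in> A then x (s j) else z j) i = x i"
        using A xz(2) by (auto simp: glue_def PiE_iff extensional_def)
    qed
    moreover have "(\<lambda>j\<in>J. if j \<in> A then glue I A s x z (s j)
        else (\<lambda>j\<in>J. if j \<in> A then x (s j) else z j) j) = z"
      using A xz(3) by (auto simp: glue_image PiE_iff extensional_def fun_eq_iff)
    ultimately show ?thesis by (simp add: xz(1) sw_def)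
  qed
  have "bij_betw sw {(x, z) \<in> ?PR. \<phi> (glue I A s x z)} ({x \<in> I \<rightarrow>\<^sub>E V. \<phi> x} \<times> (J \<rightarrow>\<^sub>E V))"
  proof (rule bij_betw_byWitness[where f' = sw])
    show "sw ` {(x, z) \<in> ?PR. \<phi> (glue I A s x z)} \<subseteq> {x \<in> I \<rightarrow>\<^sub>E V. \<phi> x} \<times> (J \<rightarrow>\<^sub>E V)"
    proof
      fix w assume "w \<in> sw ` {(x, z) \<in> ?PR. \<phi> (glue I A s x z)}"
      then obtain x z where "(x, z) \<in> ?PR" "\<phi> (glue I A s x z)" "w = sw (x, z)" by blast
      then have "w \<in> ?PR" "fst w = glue I A s x z" using sw_in by (blast, simp add: sw_def)
      with \<open>\<phi> (glue I A s x z)\<close> show "w \<in> {x \<in> I \<rightarrow>\<^sub>E V. \<phi> x} \<times> (J \<rightarrow>\<^sub>E V)"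
        by (cases w) auto
    qed
    show "sw ` ({x \<in> I \<rightarrow>\<^sub>E V. \<phi> x} \<times> (J \<rightarrow>\<^sub>E V)) \<subseteq> {(x, z) \<in> ?PR. \<phi> (glue I A s x z)}"
    proof
      fix w assume "w \<in> sw ` ({x \<in> I \<rightarrow>\<^sub>E V. \<phi> x} \<times> (J \<rightarrow>\<^sub>E V))"
      then obtain x z where xz: "(x, z) \<in> ?PR" "\<phi> x" "w = sw (x, z)" by blast
      then have "w \<in> ?PR" "sw w = (x, z)" using sw_in sw_sw by blast+
      with xz show "w \<in> {(x, z) \<in> ?PR. \<phi> (glue I A s x z)}"
        by (cases w) (auto simp: sw_def)
    qed
  qed (use sw_sw in blast)+
  from bij_betw_same_card[OF this] show ?thesis by (simp only: card_cartesian_product)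
qed

lemma card_glue_sum:
  assumes fin: "finite V" "finite I" "finite J" and A: "A \<subseteq> J" "inj_on s A" "s ` A \<subseteq> I"
  shows "(\<Sum>x\<in>I \<rightarrow>\<^sub>E V. card {z \<in> J \<rightarrow>\<^sub>E V. \<phi> (glue I A s x z)}) =
    card {x \<in> I \<rightarrow>\<^sub>E V. \<phi> x} * card (J \<rightarrow>\<^sub>E V)"
proof -
  have "{(x, z) \<in> (I \<rightarrow>\<^sub>E V) \<times> (J \<rightarrow>\<^sub>E V). \<phi> (glue I A s x z)} =
      (SIGMA x:I \<rightarrow>\<^sub>E V. {z \<in> J \<rightarrow>\<^sub>E V. \<phi> (glue I A s x z)})" by auto
  then have "card {(x, z) \<in> (I \<rightarrow>\<^sub>E V) \<times> (J \<rightarrow>\<^sub>E V). \<phi> (glue I A s x z)} =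
      (\<Sum>x\<in>I \<rightarrow>\<^sub>E V. card {z \<in> J \<rightarrow>\<^sub>E V. \<phi> (glue I A s x z)})"
    using fin by (simp add: card_SigmaI finite_PiE)
  then show ?thesis using card_glue[OF fin A, of \<phi>] by simp
qed

text \<open>Coordinate maps along injections preserve the uniform distribution. This is the case
  \<open>A = J\<close> of resampling: pulling the glued point back returns \<open>z\<close>, so
  every \<open>x\<close> contributes the same number of points \<open>z\<close>.\<close>

lemma card_pull:
  assumes fin: "finite V" "finite I" "finite J" and s: "inj_on s J" "s ` J \<subseteq> I"
  shows "card {x \<in> I \<rightarrow>\<^sub>E V. pull J s x \<in> D} * card (J \<rightarrow>\<^sub>E V) =
    card (D \<inter> (J \<rightarrow>\<^sub>E V)) * card (I \<rightarrow>\<^sub>E V)"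
proof -
  have "pull J s (glue I J s x z) = z" if "z \<in> J \<rightarrow>\<^sub>E V" for x z
    using that s by (auto simp: pull_def glue_image PiE_iff extensional_def fun_eq_iff)
  then have "{z \<in> J \<rightarrow>\<^sub>E V. pull J s (glue I J s x z) \<in> D} = D \<inter> (J \<rightarrow>\<^sub>E V)" for x
    by auto
  then show ?thesis
    using card_glue_sum[OF fin subset_refl s, of "\<lambda>x. pull J s x \<in> D"] by (simp add: mult.commute)
qed

text \<open>After resampling, the event \<open>a\<close> is decided by \<open>z\<close> alone. This
  turns a correlation on the big power into correlations on the small one.\<close>

lemma pull_glue_iff:
  assumes s: "inj_on s J" "s ` J \<subseteq> I" and A: "A \<subseteq> J" and dep: "depends_on J V A a"
    and x: "x \<in> I \<rightarrow>\<^sub>E V" and z: "z \<in> J \<rightarrow>\<^sub>E V"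
  shows "pull J s (glue I A s x z) \<in> a \<longleftrightarrow> z \<in> a"
proof -
  have "pull J s (glue I A s x z) \<in> J \<rightarrow>\<^sub>E V"
    using pull_in[OF s(2) glue_in[OF A x z]] .
  moreover have "inj_on s A" "s ` A \<subseteq> I" using s A by (auto intro: inj_on_subset)
  then have "\<forall>j\<in>A. pull J s (glue I A s x z) j = z j"
    using A by (auto simp: pull_def glue_image)
  ultimately show ?thesis using dep z unfolding depends_on_def by blast
qed

text \<open>The correlation of \<open>a\<close> and \<open>b\<close> on the big power is the average, over \<open>x\<close>, of the
  correlations of \<open>a\<close> with the section of \<open>b\<close> at \<open>x\<close>.\<close>

lemma exists_section_correlation:
  fixes V :: "'v set" and I :: "'i set" and J :: "'j set"
  assumes fin: "finite V" "finite I" "finite J" and V: "V \<noteq> {}"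
    and s: "inj_on s J" "s ` J \<subseteq> I" and A: "A \<subseteq> J" and dep: "depends_on J V A a"
  defines "P \<equiv> I \<rightarrow>\<^sub>E V" and "R \<equiv> J \<rightarrow>\<^sub>E V"
  shows "\<exists>x\<in>P. \<bar>real (card {x \<in> P. pull J s x \<in> a \<and> x \<in> b}) / card P -
        real (card {z \<in> R. z \<in> a}) / card R * (real (card {x \<in> P. x \<in> b}) / card P)\<bar>
     \<le> \<bar>real (card {z \<in> R. z \<in> a \<and> glue I A s x z \<in> b}) / card R -
        real (card {z \<in> R. z \<in> a}) / card R * (real (card {z \<in> R. glue I A s x z \<in> b}) / card R)\<bar>"
    (is "\<exists>x\<in>P. \<bar>?\<epsilon>\<bar> \<le> \<bar>?\<delta> x\<bar>")
proof (rule ccontr)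
  assume "\<not> ?thesis"
  then have small: "\<bar>?\<delta> x\<bar> < \<bar>?\<epsilon>\<bar>" if "x \<in> P" for x using that by force
  have finP: "finite P" and finR: "finite R" using fin by (simp_all add: P_def R_def finite_PiE)
  have neP: "P \<noteq> {}" and neR: "R \<noteq> {}" using V by (simp_all add: P_def R_def PiE_eq_empty_iff)
  have cP: "real (card P) > 0" and cR: "real (card R) > 0"
    using finP finR neP neR by (simp_all add: card_gt_0_iff)
  have sA: "inj_on s A" "s ` A \<subseteq> I" using s A by (auto intro: inj_on_subset)
  have "{z \<in> R. pull J s (glue I A s x z) \<in> a \<and> glue I A s x z \<in> b} =
      {z \<in> R. z \<in> a \<and> glue I A s x z \<in> b}" if "x \<in> P" for x
    using that pull_glue_iff[OF s A dep] unfolding P_def R_def by blast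
  then have 1: "(\<Sum>x\<in>P. card {z \<in> R. z \<in> a \<and> glue I A s x z \<in> b}) =
      card {x \<in> P. pull J s x \<in> a \<and> x \<in> b} * card R"
    using card_glue_sum[OF fin A sA, of "\<lambda>x. pull J s x \<in> a \<and> x \<in> b"]
    by (simp add: P_def R_def cong: sum.cong)
  have 2: "(\<Sum>x\<in>P. card {z \<in> R. glue I A s x z \<in> b}) = card {x \<in> P. x \<in> b} * card R"
    using card_glue_sum[OF fin A sA, of "\<lambda>x. x \<in> b"] by (simp add: P_def R_def)
  \<comment> \<open>The density of \<open>a\<close> is the same factor for every \<open>x\<close>,
    so the correlation is linear in the section and its average over \<open>x\<close> is exactly
    \<open>?\<epsilon>\<close>.\<close>
  have "(\<Sum>x\<in>P. ?\<delta> x) = real (\<Sum>x\<in>P. card {z \<in> R. z \<in> a \<and> glue I A s x z \<in> b}) / card R -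
      real (card {z \<in> R. z \<in> a}) / card R * (real (\<Sum>x\<in>P. card {z \<in> R. glue I A s x z \<in> b}) / card R)"
    by (simp add: sum_subtractf sum_divide_distrib sum_distrib_left)
  also have "\<dots> = real (card P) * ?\<epsilon>"
    unfolding 1 2 using cP cR by (simp add: field_simps)
  finally have "real (card P) * \<bar>?\<epsilon>\<bar> = \<bar>\<Sum>x\<in>P. ?\<delta> x\<bar>" by (simp add: abs_mult)
  also have "\<dots> \<le> (\<Sum>x\<in>P. \<bar>?\<delta> x\<bar>)" by (rule sum_abs)
  also have "\<dots> < (\<Sum>x\<in>P. \<bar>?\<epsilon>\<bar>)"
    using small by (intro sum_strict_mono finP neP)
  finally show False by simp
qed

section \<open>Coordinate maps between powers of the ultraproduct\<close>

locale power_space = ultrafilter_on_nat +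
  fixes X :: "nat \<Rightarrow> 'a set"
  assumes finX: "\<And>i. finite (X i)" and neX: "\<And>i. X i \<noteq> {}"
begin

abbreviation "M \<equiv> upower_measure \<omega> X"
abbreviation "pw \<equiv> upower \<omega> X"
abbreviation "intern J \<equiv> internal_set \<omega> (powers X J)"

definition upull :: "nat set \<Rightarrow> (nat \<Rightarrow> nat) \<Rightarrow> 'a upoint \<Rightarrow> 'a upoint" where
  "upull J s = ultra_map \<omega> (powers X J) (pull J s)"

text \<open>Finitary stand-in for measurability in the coordinates \<open>D\<close>. The approximant
  \<open>b\<close> respects these coordinates at every index, so it can be cut into sections and
  moved along coordinate maps index by index.\<close>

definition coord_approx :: "nat set \<Rightarrow> nat set \<Rightarrow> 'a upoint set \<Rightarrow> bool" where
  "coord_approx I D S \<longleftrightarrow> S \<subseteq> pw I \<and> (\<exists>b. (\<forall>i. depends_on I (X i) D (b i)) \<and>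
     ultra_null \<omega> (powers X I) (sym_diff S (intern I b)))"

lemma ultra_space_powers: "finite J \<Longrightarrow> ultra_space \<omega> (powers X J)"
  by unfold_locales (auto simp: powers_def finite_PiE PiE_eq_empty_iff finX neX)

lemma ultra_map_space_pull:
  assumes "finite I" "finite J" "inj_on s J" "s ` J \<subseteq> I"
  shows "ultra_map_space \<omega> (powers X I) (powers X J) (pull J s)"
proof -
  interpret src: ultra_space \<omega> "powers X I" by (rule ultra_space_powers) fact
  interpret tgt: ultra_space \<omega> "powers X J" by (rule ultra_space_powers) fact
  show ?thesis
  proof
    show "pull J s y \<in> powers X J i" if "y \<in> powers X I i" for y i
      using that pull_in[OF assms(4)] unfolding powers_def by blast
    show "card {y \<in> powers X I i. pull J s y \<in> D} * card (powers X J i) =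
        card (D \<inter> powers X J i) * card (powers X I i)" for i D
      unfolding powers_def by (rule card_pull[OF finX assms])
  qed
qed

lemma space_M: "finite J \<Longrightarrow> space (M J) = pw J"
  using ultra_space.space_LM[OF ultra_space_powers] by (simp add: upower_measure_def upower_def)

lemma prob_space_M: "finite J \<Longrightarrow> prob_space (M J)"
  using ultra_space.prob_space_LM[OF ultra_space_powers] by (simp add: upower_measure_def)

lemma null_sets_M: "finite J \<Longrightarrow> N \<in> null_sets (M J) \<longleftrightarrow> ultra_null \<omega> (powers X J) N"
  using ultra_space.null_sets_LM_iff[OF ultra_space_powers] by (simp add: upower_measure_def)

lemma intern_in_sets: "finite J \<Longrightarrow> intern J b \<in> sets (M J)"
  using ultra_space.internal_in_sets[OF ultra_space_powers] by (simp add: upower_measure_def)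

lemma uproj_eq: "uproj \<omega> X A = upull A (\<lambda>j. j)"
  unfolding uproj_def upull_def pull_def[abs_def] ..

lemma uperm_eq: "uperm \<omega> X k \<pi> = upull {1..k} (inv \<pi>)"
  unfolding uperm_def upull_def pull_def[abs_def] ..

lemma upull_cong: "(\<And>j. j \<in> J \<Longrightarrow> s j = s' j) \<Longrightarrow> upull J s = upull J s'"
  unfolding upull_def pull_def[abs_def] by (simp cong: restrict_cong)

context
  fixes I J :: "nat set" and s :: "nat \<Rightarrow> nat"
  assumes IJ: "finite I" "finite J" "inj_on s J" "s ` J \<subseteq> I"
begin

interpretation mp: ultra_map_space \<omega> "powers X I" "powers X J" "pull J s"
  by (rule ultra_map_space_pull[OF IJ])

lemma upull_in: "c \<in> pw I \<Longrightarrow> upull J s c \<in> pw J"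
  unfolding upull_def upower_def by (rule mp.ultra_map_in)

lemma measurable_upull: "upull J s \<in> M I \<rightarrow>\<^sub>M M J"
  unfolding upull_def upower_measure_def by (rule mp.measurable_ultra_map)

lemma null_upull: "N \<in> null_sets (M J) \<Longrightarrow> upull J s -` N \<inter> pw I \<in> null_sets (M I)"
  using mp.null_vimage[of N] by (simp add: null_sets_M IJ upull_def upower_def)

lemma vimage_upull_intern: "upull J s -` intern J b \<inter> pw I = intern I (\<lambda>i. pull J s -` b i)"
  unfolding upull_def upower_def by (rule mp.vimage_internal)

lemma upull_upull:
  assumes A: "inj_on t A" "t ` A \<subseteq> J" and c: "c \<in> pw I"
  shows "upull A t (upull J s c) = upull A (\<lambda>j. s (t j)) c"
proof -
  have "finite A" using A IJ finite_subset finite_imageD by metis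
  interpret m2: ultra_map_space \<omega> "powers X J" "powers X A" "pull A t"
    by (rule ultra_map_space_pull) fact+
  have "inj_on (\<lambda>j. s (t j)) A"
    using comp_inj_on[OF A(1) inj_on_subset[OF IJ(3) A(2)]] by (simp add: comp_def)
  then interpret m3: ultra_map_space \<omega> "powers X I" "powers X A" "pull A (\<lambda>j. s (t j))"
    using A IJ \<open>finite A\<close> by (intro ultra_map_space_pull) auto
  obtain p where p: "\<And>i. p i \<in> powers X I i" "c = mp.src.cls p"
    using c mp.src.ultraproductE unfolding upower_def by blast
  have "pull A t (pull J s x) = pull A (\<lambda>j. s (t j)) x" for x :: "nat \<Rightarrow> 'a"
    using A by (auto simp: pull_def fun_eq_iff)
  then show ?thesis
    unfolding upull_def p(2) using p(1)
    by (simp add: mp.ultra_map_cls m2.ultra_map_cls m3.ultra_map_cls mp.maps)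
qed

lemma coord_approx_upull:
  assumes A: "A \<subseteq> J" and S: "coord_approx J A S"
  shows "coord_approx I (s ` A) (upull J s -` S \<inter> pw I)"
proof -
  obtain b where b: "\<And>i. depends_on J (X i) A (b i)"
      "ultra_null \<omega> (powers X J) (sym_diff S (intern J b))"
    using S by (auto simp: coord_approx_def)
  have "depends_on I (X i) (s ` A) (pull J s -` b i)" for i
    unfolding depends_on_def
  proof (intro ballI impI)
    fix x y assume xy: "x \<in> I \<rightarrow>\<^sub>E X i" "y \<in> I \<rightarrow>\<^sub>E X i" "\<forall>j\<in>s ` A. x j = y j"
    then have "\<forall>j\<in>A. pull J s x j = pull J s y j" using A by (auto simp: pull_def)
    with b(1)[of i] pull_in[OF IJ(4) xy(1)] pull_in[OF IJ(4) xy(2)]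
    show "x \<in> pull J s -` b i \<longleftrightarrow> y \<in> pull J s -` b i"
      unfolding depends_on_def by blast
  qed
  moreover note mp.vimage_approx[OF b(2)]
  ultimately show ?thesis
    unfolding coord_approx_def upull_def upower_def
    by (intro conjI exI[of _ "\<lambda>i. pull J s -` b i"]) auto
qed

end

text \<open>On the power over \<open>A\<close> itself every set depends only on the coordinates in
  \<open>A\<close>, since these determine the point. The claim is the pullback of this trivial case
  along the inclusion of \<open>A\<close>.\<close>

lemma sigma_proj_approx:
  assumes A: "A \<subseteq> {1..k}" and S: "S \<in> sigma_proj \<omega> X k A"
  shows "coord_approx {1..k} A S"
proof -
  have fA: "finite A" using A finite_subset by blast
  interpret A: ultra_space \<omega> "powers X A" by (rule ultra_space_powers[OF fA])
  obtain B where B: "S = uproj \<omega> X A -` B \<inter> upower \<omega> X {1..k}" "B \<in> sets (M A)"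
    using S by (auto simp: sigma_proj_def)
  obtain b where b: "A.null (sym_diff B (A.internal b))" "B \<subseteq> A.\<Omega>"
    using B(2) by (auto simp: upower_measure_def A.sets_LM A.ultra_sets_iff)
  have "depends_on A (X i) A (b i)" for i
    unfolding depends_on_def by (metis PiE_ext)
  then have "coord_approx A A B"
    using b by (auto simp: coord_approx_def upower_def)
  from coord_approx_upull[OF _ fA _ _ subset_refl this, of "{1..k}" "\<lambda>j. j"] A show ?thesis
    by (simp add: B(1) uproj_eq)
qed

lemma sigma_proj_in_sets:
  assumes A: "A \<subseteq> {1..k}"
  shows "sigma_proj \<omega> X k A \<subseteq> sets (M {1..k})"
proof -
  have "finite A" using A finite_subset by blast
  then show ?thesis
    using measurable_sets[OF measurable_upull[of "{1..k}" A "\<lambda>j. j"]] A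
    by (auto simp: sigma_proj_def uproj_eq space_M)
qed

text \<open>The way back from approximants to sigma-algebras. At each index a set that does not see
  the coordinates outside \<open>B\<close> is the full preimage of its projection
  \<open>b i\<close>, so for internal sets no null set is lost.\<close>

lemma intern_in_sigma_proj:
  assumes B: "B \<subseteq> {1..k}" and c: "\<And>i. depends_on {1..k} (X i) B (c i)"
  shows "intern {1..k} c \<in> sigma_proj \<omega> X k B"
proof -
  have fB: "finite B" using B finite_subset by blast
  interpret K: ultra_space \<omega> "powers X {1..k}" by (rule ultra_space_powers) simp
  define b where "b i = (\<lambda>z. restrict z B) ` (c i \<inter> powers X {1..k} i)" for i
  have "intern {1..k} c = intern {1..k} (\<lambda>i. pull B (\<lambda>j. j) -` b i)"
  proof (rule K.internal_cong)
    fix i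
    have "z \<in> c i \<longleftrightarrow> restrict z B \<in> b i" if z: "z \<in> powers X {1..k} i" for z
    proof
      assume "restrict z B \<in> b i"
      then obtain w where "w \<in> c i" "w \<in> powers X {1..k} i" "restrict z B = restrict w B"
        by (auto simp: b_def)
      moreover from this have "\<forall>j\<in>B. z j = w j" by (metis restrict_apply)
      ultimately show "z \<in> c i" using c[of i] z unfolding depends_on_def powers_def by blast
    qed (use z in \<open>auto simp: b_def\<close>)
    then show "c i \<inter> powers X {1..k} i = pull B (\<lambda>j. j) -` b i \<inter> powers X {1..k} i"
      by (auto simp: pull_def)
  qed
  also have "\<dots> = uproj \<omega> X B -` intern B b \<inter> pw {1..k}"
    using vimage_upull_intern[of "{1..k}" B "\<lambda>j. j" b] B fB by (simp add: uproj_eq)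
  finally show ?thesis
    using intern_in_sets[OF fB, of b] by (auto simp: sigma_proj_def)
qed

end

section \<open>Independence of the coordinates of a realization\<close>

locale realization = power_space +
  fixes k :: nat and l :: "nat set \<Rightarrow> 'a upoint set set" and F :: "nat set \<Rightarrow> 'a upoint \<Rightarrow> real"
  assumes realization: "separable_realization \<omega> X k l F"
begin

lemma realizationD:
  assumes "A \<in> nonempty_subsets k"
  shows "sigma_algebra (pw {1..k}) (l A)" "l A \<subseteq> sigma_proj \<omega> X k A"
    "prob_space.indep_set (M {1..k}) (l A) (sigma_star \<omega> X k A)"
    "F A \<in> measurable (measure_of (pw {1..k}) (l A) (emeasure (M {1..k}))) unit_interval"
    "induces_measure_algebra_iso (measure_of (pw {1..k}) (l A) (emeasure (M {1..k}))) unit_interval (F A)"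
    "\<And>x \<pi>. x \<in> pw {1..k} \<Longrightarrow> \<pi> permutes {1..k} \<Longrightarrow> F A x = F (\<pi> ` A) (uperm \<omega> X k \<pi> x)"
proof -
  note r = bspec[OF realization[unfolded separable_realization_def Let_def] assms]
  show "sigma_algebra (pw {1..k}) (l A)" "l A \<subseteq> sigma_proj \<omega> X k A"
    "prob_space.indep_set (M {1..k}) (l A) (sigma_star \<omega> X k A)"
    "F A \<in> measurable (measure_of (pw {1..k}) (l A) (emeasure (M {1..k}))) unit_interval"
    "induces_measure_algebra_iso (measure_of (pw {1..k}) (l A) (emeasure (M {1..k}))) unit_interval (F A)"
    by (rule r[THEN conjunct1] r[THEN conjunct2, THEN conjunct2, THEN conjunct2, THEN conjunct1]
        r[THEN conjunct2, THEN conjunct2, THEN conjunct2, THEN conjunct2, THEN conjunct1]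
        r[THEN conjunct2, THEN conjunct2, THEN conjunct2, THEN conjunct2, THEN conjunct2,
          THEN conjunct2, THEN conjunct2, THEN conjunct1]
        r[THEN conjunct2, THEN conjunct2, THEN conjunct2, THEN conjunct2, THEN conjunct2,
          THEN conjunct2, THEN conjunct2, THEN conjunct2, THEN conjunct1])+
  show "F A x = F (\<pi> ` A) (uperm \<omega> X k \<pi> x)" if "x \<in> pw {1..k}" "\<pi> permutes {1..k}" for x \<pi>
    using r that by (elim conjE) simp
qed

lemma nonempty_subsetsD: "A \<in> nonempty_subsets k \<Longrightarrow> A \<subseteq> {1..k}"
  by (auto simp: nonempty_subsets_def)

context
  fixes A assumes A: "A \<in> nonempty_subsets k"
begin

lemma l_in_sets: "l A \<subseteq> sets (M {1..k})"
  using realizationD(2)[OF A] sigma_proj_in_sets[OF nonempty_subsetsD[OF A]] by blast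

lemma vimage_F_in_l:
  assumes "U \<in> sets unit_interval"
  shows "F A -` U \<inter> pw {1..k} \<in> l A"
proof -
  note sa = realizationD(1)[OF A]
  have "l A \<subseteq> Pow (pw {1..k})" using sa by (simp add: sigma_algebra_iff2)
  then show ?thesis
    using measurable_sets[OF realizationD(4)[OF A] assms] sigma_algebra.sets_measure_of_eq[OF sa]
    by (simp add: space_measure_of)
qed

lemma emeasure_vimage_F:
  assumes U: "U \<in> sets unit_interval"
  shows "emeasure (M {1..k}) (F A -` U \<inter> pw {1..k}) = emeasure unit_interval U"
proof -
  note sa = realizationD(1)[OF A]
  have sub: "l A \<subseteq> Pow (pw {1..k})" using sa by (simp add: sigma_algebra_iff2)
  \<comment> \<open>\<open>measure_of\<close> yields the zero measure unless the given function is a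
    measure on the sigma-algebra, so the restriction of the Loeb measure to \<open>l A\<close> has
    to be checked before it can be evaluated.\<close>
  have "countably_additive (l A) (emeasure (M {1..k}))"
  proof (rule countably_additiveI)
    fix S :: "nat \<Rightarrow> _" assume "range S \<subseteq> l A" "disjoint_family S"
    then show "(\<Sum>i. emeasure (M {1..k}) (S i)) = emeasure (M {1..k}) (\<Union>i. S i)"
      using l_in_sets by (intro suminf_emeasure) auto
  qed
  moreover have "positive (l A) (emeasure (M {1..k}))" by (simp add: positive_def)
  ultimately have "emeasure (measure_of (pw {1..k}) (l A) (emeasure (M {1..k}))) (F A -` U \<inter> pw {1..k})
      = emeasure (M {1..k}) (F A -` U \<inter> pw {1..k})"
    using emeasure_measure_of_sigma[OF sa] vimage_F_in_l[OF U] by blast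
  then show ?thesis
    using realizationD(5)[OF A] U sub by (simp add: induces_measure_algebra_iso_def space_measure_of)
qed

lemma F_in_unit: "x \<in> pw {1..k} \<Longrightarrow> F A x \<in> {0..1}"
proof -
  assume x: "x \<in> pw {1..k}"
  have sub: "l A \<subseteq> Pow (pw {1..k})" using realizationD(1)[OF A] by (simp add: sigma_algebra_iff2)
  then show ?thesis
    using measurable_space[OF realizationD(4)[OF A], of x] x
    by (simp add: space_measure_of unit_interval_def space_restrict_space)
qed

lemma measurable_F: "F A \<in> M {1..k} \<rightarrow>\<^sub>M unit_interval"
proof (rule measurableI)
  show "F A x \<in> space unit_interval" if "x \<in> space (M {1..k})" for x
    using that F_in_unit by (simp add: space_M unit_interval_def space_restrict_space)
  show "F A -` U \<inter> space (M {1..k}) \<in> sets (M {1..k})" if "U \<in> sets unit_interval" for U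
    using vimage_F_in_l[OF that] l_in_sets by (auto simp: space_M)
qed

text \<open>Holds at every point, not just almost everywhere: singletons are measurable in the
  interval, so each fibre of \<open>F A\<close> lies in \<open>sigma_proj\<close> and is a preimage
  under the projection to \<open>A\<close>.\<close>

lemma F_depends:
  assumes x: "x \<in> pw {1..k}" and y: "y \<in> pw {1..k}" and eq: "uproj \<omega> X A x = uproj \<omega> X A y"
  shows "F A x = F A y"
proof -
  have "{F A x} \<in> sets unit_interval"
    using F_in_unit[OF x] by (simp add: unit_interval_def sets_restrict_space_iff)
  then have "F A -` {F A x} \<inter> pw {1..k} \<in> sigma_proj \<omega> X k A"
    using vimage_F_in_l realizationD(2)[OF A] by blast
  then obtain B where B: "F A -` {F A x} \<inter> pw {1..k} = uproj \<omega> X A -` B \<inter> pw {1..k}"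
    by (auto simp: sigma_proj_def)
  have "x \<in> F A -` {F A x} \<inter> pw {1..k}" using x by simp
  then have "y \<in> F A -` {F A x} \<inter> pw {1..k}" unfolding B using eq y by simp
  then show ?thesis by simp
qed

text \<open>For suitable \<open>x i\<close> the correlation on \<open>X\<^sup>I\<close> is bounded by that of \<open>S\<close> with the section at
  \<open>x i\<close> of the intersection of the \<open>T D\<close>.  This section lies in \<open>sigma_star A\<close>, since \<open>T D\<close>
  does not see some coordinate of \<open>t ` A\<close>.\<close>

lemma measure_Int_eq_mult:
  assumes S: "S \<in> l A" and I: "finite I" and t: "inj_on t {1..k}" "t ` {1..k} \<subseteq> I"
    and fin: "finite \<D>" and nsub: "\<And>D. D \<in> \<D> \<Longrightarrow> \<not> t ` A \<subseteq> D"
    and T: "\<And>D. D \<in> \<D> \<Longrightarrow> coord_approx I D (T D)"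
  shows "measure (M I) ((upull {1..k} t -` S \<inter> pw I) \<inter> (pw I \<inter> (\<Inter>D\<in>\<D>. T D))) =
    measure (M {1..k}) S * measure (M I) (pw I \<inter> (\<Inter>D\<in>\<D>. T D))"
proof -
  note Ak = nonempty_subsetsD[OF A]
  interpret mp: ultra_map_space \<omega> "powers X I" "powers X {1..k}" "pull {1..k} t"
    by (rule ultra_map_space_pull) (use I t in auto)
  have pwI: "pw I = mp.src.\<Omega>" and pwk: "pw {1..k} = mp.tgt.\<Omega>"
    and MI: "M I = mp.src.LM" and Mk: "M {1..k} = mp.tgt.LM"
    by (simp_all add: upower_def upower_measure_def)
  have "coord_approx {1..k} A S"
    using sigma_proj_approx[OF Ak] realizationD(2)[OF A] S by blast
  then obtain a where a: "\<And>i. depends_on {1..k} (X i) A (a i)" "S \<subseteq> mp.tgt.\<Omega>"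
      "mp.tgt.null (sym_diff S (mp.tgt.internal a))"
    by (auto simp: coord_approx_def upower_def)
  have "\<forall>D\<in>\<D>. \<exists>b. (\<forall>i. depends_on I (X i) D (b i)) \<and> mp.src.null (sym_diff (T D) (mp.src.internal b))"
    using T by (auto simp: coord_approx_def)
  then obtain b where b: "\<And>D i. D \<in> \<D> \<Longrightarrow> depends_on I (X i) D (b D i)"
      "\<And>D. D \<in> \<D> \<Longrightarrow> mp.src.null (sym_diff (T D) (mp.src.internal (b D)))"
    by (subst (asm) bchoice_iff) blast
  define bb where "bb i = powers X I i \<inter> (\<Inter>D\<in>\<D>. b D i)" for i
  have bb_int: "mp.src.internal bb = mp.src.\<Omega> \<inter> (\<Inter>D\<in>\<D>. mp.src.internal (b D))"
    unfolding bb_def[abs_def] by (rule mp.src.internal_INT_finite[OF fin])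
  let ?g = "glue I A t"
  let ?P = "\<lambda>i. I \<rightarrow>\<^sub>E X i" and ?R = "\<lambda>i. {1..k} \<rightarrow>\<^sub>E X i"
  define good where "good i x \<longleftrightarrow>
     \<bar>real (card {x \<in> ?P i. pull {1..k} t x \<in> a i \<and> x \<in> bb i}) / card (?P i) -
        real (card {z \<in> ?R i. z \<in> a i}) / card (?R i) * (real (card {x \<in> ?P i. x \<in> bb i}) / card (?P i))\<bar>
     \<le> \<bar>real (card {z \<in> ?R i. z \<in> a i \<and> ?g x z \<in> bb i}) / card (?R i) -
        real (card {z \<in> ?R i. z \<in> a i}) / card (?R i) * (real (card {z \<in> ?R i. ?g x z \<in> bb i}) / card (?R i))\<bar>"
    for i x
  have "\<exists>x\<in>?P i. good i x" for i
    unfolding good_def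
    by (rule exists_section_correlation[OF finX I _ neX t Ak a(1)]) simp
  then obtain x where x: "\<And>i. x i \<in> ?P i" and xle: "\<And>i. good i (x i)"
    by metis
  \<comment> \<open>The section points \<open>x i\<close> are chosen separately at each index, with
    no coherence between them. Any such choice still makes the sections into a single internal set,
    and the independence of \<open>l A\<close> can be applied to that set.\<close>
  define c where "c i = {z. ?g (x i) z \<in> bb i}" for i
  define cD where "cD D i = {z. ?g (x i) z \<in> b D i}" for D i
  have dens: "\<bar>mp.src.dens (\<lambda>i. pull {1..k} t -` a i \<inter> bb i) i - mp.tgt.dens a i * mp.src.dens bb i\<bar>
      \<le> \<bar>mp.tgt.dens (\<lambda>i. a i \<inter> c i) i - mp.tgt.dens a i * mp.tgt.dens c i\<bar>" for i
  proof -
    have "pull {1..k} t -` a i \<inter> bb i \<inter> powers X I i = {x \<in> ?P i. pull {1..k} t x \<in> a i \<and> x \<in> bb i}"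
      "a i \<inter> powers X {1..k} i = {z \<in> ?R i. z \<in> a i}"
      "bb i \<inter> powers X I i = {x \<in> ?P i. x \<in> bb i}"
      "a i \<inter> c i \<inter> powers X {1..k} i = {z \<in> ?R i. z \<in> a i \<and> ?g (x i) z \<in> bb i}"
      "c i \<inter> powers X {1..k} i = {z \<in> ?R i. ?g (x i) z \<in> bb i}"
      by (auto simp: powers_def c_def)
    then show ?thesis
      unfolding mp.src.dens_def mp.tgt.dens_def using xle[of i] by (simp only: powers_def good_def)
  qed
  have c_star: "mp.tgt.internal c \<in> sigma_star \<omega> X k A"
  proof -
    interpret star: sigma_algebra "pw {1..k}" "sigma_star \<omega> X k A"
      unfolding sigma_star_def by (rule sigma_algebra_sigma_sets) (auto simp: sigma_proj_def)
    have cD: "mp.tgt.internal (cD D) \<in> sigma_star \<omega> X k A" if D: "D \<in> \<D>" for D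
    proof -
      \<comment> \<open>\<open>glue\<close> reads no coordinate of \<open>z\<close> outside
        \<open>A\<close>, and it reads \<open>z j\<close> only at the place \<open>t j\<close>,
        which \<open>D\<close> does not see. Hence the section depends only on
        \<open>A - {j}\<close>, one of the generating index sets of
        \<open>sigma_star\<close>.\<close>
      obtain j where j: "j \<in> A" "t j \<notin> D" using nsub[OF D] by blast
      have fA: "finite A" using Ak finite_subset by blast
      have "depends_on {1..k} (X i) (A - {j}) (cD D i)" for i
        unfolding depends_on_def
      proof (intro ballI impI)
        fix z w assume zw: "z \<in> ?R i" "w \<in> ?R i" "\<forall>j\<in>A - {j}. z j = w j"
        have tA: "inj_on t A" using t(1) Ak by (rule inj_on_subset)
        have "?g (x i) z m = ?g (x i) w m" if "m \<in> D" for m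
        proof (cases "m \<in> t ` A")
          case True
          then obtain j' where "j' \<in> A" "m = t j'" by blast
          with that j zw(3) tA show ?thesis by (auto simp: glue_def)
        qed (simp add: glue_def)
        moreover have "?g (x i) z \<in> ?P i" "?g (x i) w \<in> ?P i"
          using glue_in[OF Ak x] zw by blast+
        ultimately show "z \<in> cD D i \<longleftrightarrow> w \<in> cD D i"
          using b(1)[OF D, of i] unfolding depends_on_def cD_def by blast
      qed
      then have "mp.tgt.internal (cD D) \<in> sigma_proj \<omega> X k (A - {j})"
        using Ak by (intro intern_in_sigma_proj) auto
      moreover have "A - {j} \<in> {B. B \<subseteq> A \<and> card B = card A - 1}" using j fA by simp
      ultimately show ?thesis
        unfolding sigma_star_def by (blast intro: sigma_sets.Basic)
    qed
    have "mp.tgt.internal c = mp.tgt.internal (\<lambda>i. powers X {1..k} i \<inter> (\<Inter>D\<in>\<D>. cD D i))"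
    proof (rule mp.tgt.internal_cong)
      fix i
      have "?g (x i) z \<in> powers X I i" if "z \<in> powers X {1..k} i" for z
        using glue_in[OF Ak x] that unfolding powers_def by blast
      then show "c i \<inter> powers X {1..k} i = powers X {1..k} i \<inter> (\<Inter>D\<in>\<D>. cD D i) \<inter> powers X {1..k} i"
        by (auto simp: c_def cD_def bb_def)
    qed
    also have "\<dots> = pw {1..k} \<inter> (\<Inter>D\<in>\<D>. mp.tgt.internal (cD D))"
      unfolding pwk by (rule mp.tgt.internal_INT_finite[OF fin])
    also have "\<dots> \<in> sigma_star \<omega> X k A"
      using fin cD
    proof (induction \<D> rule: finite_induct)
      case empty
      show ?case using star.top by simp
    next
      case (insert D \<D>)
      have "pw {1..k} \<inter> (\<Inter>D\<in>insert D \<D>. mp.tgt.internal (cD D)) =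
          mp.tgt.internal (cD D) \<inter> (pw {1..k} \<inter> (\<Inter>D\<in>\<D>. mp.tgt.internal (cD D)))" by blast
      also have "\<dots> \<in> sigma_star \<omega> X k A"
        by (rule star.Int[OF insert.prems[OF insertI1] insert.IH[OF insert.prems[OF insertI2]]])
      finally show ?case .
    qed
    finally show ?thesis .
  qed
  have "mp.tgt.lim_dens (\<lambda>i. a i \<inter> c i) = mp.tgt.lim_dens a * mp.tgt.lim_dens c"
  proof -
    have "mp.tgt.null (sym_diff (S \<inter> mp.tgt.internal c) (mp.tgt.internal (\<lambda>i. a i \<inter> c i)))"
      by (rule mp.tgt.null_subset[OF a(3)]) (unfold mp.tgt.internal_Int, blast)
    then have "mp.tgt.lim_dens (\<lambda>i. a i \<inter> c i) = measure (M {1..k}) (S \<inter> mp.tgt.internal c)"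
      unfolding Mk using a(2) by (intro mp.tgt.measure_eq_lim_dens[symmetric]) blast
    also have "\<dots> = measure (M {1..k}) S * measure (M {1..k}) (mp.tgt.internal c)"
      by (rule prob_space.indep_setD[OF prob_space_M realizationD(3)[OF A] S c_star]) simp
    also have "\<dots> = mp.tgt.lim_dens a * mp.tgt.lim_dens c"
      unfolding Mk mp.tgt.measure_eq_lim_dens[OF a(2,3)] mp.tgt.measure_internal ..
    finally show ?thesis .
  qed
  then have "((\<lambda>i. mp.tgt.dens (\<lambda>i. a i \<inter> c i) i - mp.tgt.dens a i * mp.tgt.dens c i) \<longlongrightarrow> 0) \<omega>"
    using tendsto_diff[OF mp.tgt.dens_tendsto[of "\<lambda>i. a i \<inter> c i"]
        tendsto_mult[OF mp.tgt.dens_tendsto[of a] mp.tgt.dens_tendsto[of c]]] by simp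
  then have "((\<lambda>i. \<bar>mp.tgt.dens (\<lambda>i. a i \<inter> c i) i - mp.tgt.dens a i * mp.tgt.dens c i\<bar>) \<longlongrightarrow> 0) \<omega>"
    by (rule tendsto_rabs_zero)
  then have lim0: "((\<lambda>i. mp.src.dens (\<lambda>i. pull {1..k} t -` a i \<inter> bb i) i
      - mp.tgt.dens a i * mp.src.dens bb i) \<longlongrightarrow> 0) \<omega>"
    by (rule Lim_null_comparison[rotated])
      (unfold real_norm_def, intro always_eventually allI dens)
  have "((\<lambda>i. mp.src.dens (\<lambda>i. pull {1..k} t -` a i \<inter> bb i) i
      - mp.tgt.dens a i * mp.src.dens bb i) \<longlongrightarrow>
      mp.src.lim_dens (\<lambda>i. pull {1..k} t -` a i \<inter> bb i) - mp.tgt.lim_dens a * mp.src.lim_dens bb) \<omega>"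
    by (intro tendsto_intros mp.src.dens_tendsto mp.tgt.dens_tendsto)
  from tendsto_unique[OF nontrivial this lim0] have main: "mp.src.lim_dens (\<lambda>i. pull {1..k} t -` a i \<inter> bb i) =
      mp.tgt.lim_dens a * mp.src.lim_dens bb"
    by (rule iffD2[OF eq_iff_diff_eq_0])
  have nullT: "mp.src.null (\<Union>D\<in>\<D>. sym_diff (T D) (mp.src.internal (b D)))"
    using b(2) fin unfolding mp.src.null_sets_LM_iff[symmetric] by (intro null_sets_UN') (auto intro: countable_finite)
  have Tbb: "mp.src.null (sym_diff (pw I \<inter> (\<Inter>D\<in>\<D>. T D)) (mp.src.internal bb))"
    by (rule mp.src.null_subset[OF nullT]) (unfold bb_int pwI, blast)
  have "mp.src.null (sym_diff ((upull {1..k} t -` S \<inter> pw I) \<inter> (pw I \<inter> (\<Inter>D\<in>\<D>. T D)))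
      (mp.src.internal (\<lambda>i. pull {1..k} t -` a i \<inter> bb i)))"
    by (rule mp.src.null_subset[OF mp.src.null_Un[OF mp.vimage_approx[OF a(3)] Tbb]])
      (unfold mp.src.internal_Int upull_def pwI, blast)
  then have "measure (M I) ((upull {1..k} t -` S \<inter> pw I) \<inter> (pw I \<inter> (\<Inter>D\<in>\<D>. T D))) =
      mp.src.lim_dens (\<lambda>i. pull {1..k} t -` a i \<inter> bb i)"
    unfolding MI by (intro mp.src.measure_eq_lim_dens) (unfold pwI, blast)
  moreover have "measure (M I) (pw I \<inter> (\<Inter>D\<in>\<D>. T D)) = mp.src.lim_dens bb"
    unfolding MI using Tbb by (intro mp.src.measure_eq_lim_dens) (auto simp: pwI)
  moreover have "measure (M {1..k}) S = mp.tgt.lim_dens a"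
    unfolding Mk by (rule mp.tgt.measure_eq_lim_dens[OF a(2,3)])
  ultimately show ?thesis using main by simp
qed

end

end

lemma prob_space_unit_interval: "prob_space unit_interval"
  unfolding unit_interval_def by (rule prob_space_restrict_space) auto

text \<open>Two presentations of a set inside edges differ by a bijection between subsets of
  \<open>[k]\<close>, whereas the symmetry of a realization is stated for permutations of all of
  \<open>[k]\<close>.\<close>

lemma bij_betw_extends_to_permutation:
  assumes fin: "finite S" and sub: "A \<subseteq> S" "B \<subseteq> S" and h: "bij_betw h A B"
  obtains \<pi> where "\<pi> permutes S" "\<And>j. j \<in> A \<Longrightarrow> \<pi> j = h j"
proof -
  have finA: "finite A" and finB: "finite B" using fin sub finite_subset by blast+
  have "card A = card B" using h by (rule bij_betw_same_card)
  then have cards: "card (S - A) = card (S - B)"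
    using finA finB sub by (simp add: card_Diff_subset)
  obtain g where g: "bij_betw g (S - A) (S - B)"
    using finite_same_card_bij[OF finite_Diff[OF fin] finite_Diff[OF fin] cards] by blast
  define \<pi> where "\<pi> j = (if j \<in> A then h j else if j \<in> S then g j else j)" for j
  have "bij_betw \<pi> A B" using h by (rule bij_betw_cong[THEN iffD1, rotated]) (simp add: \<pi>_def)
  moreover have "bij_betw \<pi> (S - A) (S - B)"
    using g by (rule bij_betw_cong[THEN iffD1, rotated]) (simp add: \<pi>_def)
  ultimately have "bij_betw \<pi> (A \<union> (S - A)) (B \<union> (S - B))"
    by (rule bij_betw_combine) auto
  moreover have "A \<union> (S - A) = S" "B \<union> (S - B) = S" using sub by auto
  ultimately have "bij_betw \<pi> S S" by simp
  then have "\<pi> permutes S"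
    by (rule bij_imp_permutes) (use sub in \<open>auto simp: \<pi>_def\<close>)
  then show thesis by (rule that) (simp add: \<pi>_def)
qed

section \<open>One coordinate function for each nonempty subset of an edge\<close>

locale realization_hypergraph = realization +
  fixes n :: nat and K :: "nat set set" and s :: "nat set \<Rightarrow> nat \<Rightarrow> nat"
  assumes K: "uniform_hypergraph k {1..n} K"
    and s: "\<And>e. e \<in> K \<Longrightarrow> bij_betw (s e) {1..k} e"
begin

abbreviation "ES \<equiv> edge_subsets K"
abbreviation "NE \<equiv> nonempty_subsets k"
abbreviation "Tm e \<equiv> upull {1..k} (s e)"

lemma finite_K: "finite K"
  using K by (intro finite_subset[of K "Pow {1..n}"]) (auto simp: uniform_hypergraph_def)

lemma finite_ES: "finite ES"
  using K by (intro finite_subset[of ES "Pow {1..n}"]) (auto simp: uniform_hypergraph_def edge_subsets_def)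

lemma finite_in_ES: "C \<in> ES \<Longrightarrow> finite C"
proof -
  assume "C \<in> ES"
  then obtain e where "e \<in> K" "C \<subseteq> e" by (auto simp: edge_subsets_def)
  moreover from this have "finite e" using K by (simp add: uniform_hypergraph_def)
  ultimately show ?thesis using finite_subset by blast
qed

lemma s_inj: "e \<in> K \<Longrightarrow> inj_on (s e) {1..k}"
  using s by (rule bij_betw_imp_inj_on)

lemma s_image: "e \<in> K \<Longrightarrow> s e ` {1..k} = e"
  using s by (rule bij_betw_imp_surj_on)

lemma s_in: "e \<in> K \<Longrightarrow> s e ` {1..k} \<subseteq> {1..n}"
  using K s_image by (simp add: uniform_hypergraph_def)

lemma image_in_ES: "e \<in> K \<Longrightarrow> A \<in> NE \<Longrightarrow> s e ` A \<in> ES"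
  using s_image[of e] unfolding edge_subsets_def nonempty_subsets_def by blast

lemma ES_rep:
  assumes "C \<in> ES"
  shows "\<exists>eA. fst eA \<in> K \<and> snd eA \<in> NE \<and> s (fst eA) ` snd eA = C"
proof -
  obtain e where e: "C \<noteq> {}" "e \<in> K" "C \<subseteq> e" using assms by (auto simp: edge_subsets_def)
  then obtain A where "A \<subseteq> {1..k}" "C = s e ` A"
    using s_image[of e] by (metis subset_imageE)
  with e show ?thesis
    by (intro exI[of _ "(e, A)"]) (auto simp: nonempty_subsets_def)
qed

text \<open>The transition \<open>A \<rightarrow> A'\<close> between the two labellings extends to a
  permutation \<open>\<pi>\<close> of \<open>[k]\<close>, which moves \<open>F A\<close> to
  \<open>F A'\<close>. The labelling \<open>s e\<close> composed with the inverse of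
  \<open>\<pi>\<close> agrees with \<open>s e'\<close> on \<open>A'\<close> but perhaps not
  elsewhere; \<open>F_depends\<close> makes the difference harmless.\<close>

lemma F_consistent:
  assumes e: "e \<in> K" "e' \<in> K" and A: "A \<in> NE" "A' \<in> NE" and eq: "s e ` A = s e' ` A'"
    and x: "x \<in> pw {1..n}"
  shows "F A (Tm e x) = F A' (Tm e' x)"
proof -
  note Ak = nonempty_subsetsD[OF A(1)] nonempty_subsetsD[OF A(2)]
  have "bij_betw (s e) A (s e ` A)" "bij_betw (s e') A' (s e' ` A')"
    using inj_on_subset[OF s_inj[OF e(1)] Ak(1)] inj_on_subset[OF s_inj[OF e(2)] Ak(2)]
    by (simp_all add: bij_betw_imageI)
  then have h: "bij_betw (inv_into A' (s e') \<circ> s e) A A'"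
    unfolding eq by (intro bij_betw_trans) (auto intro: bij_betw_inv_into)
  obtain \<pi> where \<pi>: "\<pi> permutes {1..k}" "\<And>j. j \<in> A \<Longrightarrow> \<pi> j = inv_into A' (s e') (s e j)"
    using bij_betw_extends_to_permutation[OF _ Ak h] by auto
  have img: "\<pi> ` A = A'" using h \<pi>(2) by (auto simp: bij_betw_def)
  have s_back: "s e (inv \<pi> j) = s e' j" if j: "j \<in> A'" for j
  proof -
    obtain i where i: "i \<in> A" "j = \<pi> i" using j img by blast
    have "s e' (\<pi> i) = s e i"
      unfolding \<pi>(2)[OF i(1)] by (rule f_inv_into_f) (use i eq in auto)
    then show ?thesis using i permutes_inverses(2)[OF \<pi>(1)] by simp
  qed
  have inv\<pi>: "inj_on (inv \<pi>) {1..k}" "inv \<pi> ` {1..k} = {1..k}"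
    using permutes_inv[OF \<pi>(1)] by (simp_all add: permutes_inj_on permutes_image)
  have se: "inj_on (\<lambda>j. s e (inv \<pi> j)) {1..k}" "(\<lambda>j. s e (inv \<pi> j)) ` {1..k} \<subseteq> {1..n}"
    using comp_inj_on[OF inv\<pi>(1), of "s e"] s_inj[OF e(1)] s_in[OF e(1)] inv\<pi>(2)
    by (simp_all only: comp_def) (metis image_image)
  have Tx: "Tm e x \<in> pw {1..k}" "Tm e' x \<in> pw {1..k}"
    using upull_in[OF _ _ s_inj s_in] e x by blast+
  have "F A (Tm e x) = F A' (uperm \<omega> X k \<pi> (Tm e x))"
    using realizationD(6)[OF A(1) Tx(1) \<pi>(1)] img by simp
  also have "uperm \<omega> X k \<pi> (Tm e x) = upull {1..k} (\<lambda>j. s e (inv \<pi> j)) x"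
    unfolding uperm_eq
    by (rule upull_upull[OF _ _ s_inj[OF e(1)] s_in[OF e(1)]]) (use inv\<pi> x in simp_all)
  also have "F A' \<dots> = F A' (Tm e' x)"
  proof (rule F_depends[OF A(2) _ Tx(2)])
    show "upull {1..k} (\<lambda>j. s e (inv \<pi> j)) x \<in> pw {1..k}"
      by (rule upull_in[OF _ _ se x]) simp_all
    have "uproj \<omega> X A' (upull {1..k} (\<lambda>j. s e (inv \<pi> j)) x) = upull A' (\<lambda>j. s e (inv \<pi> j)) x"
      unfolding uproj_eq by (rule upull_upull[OF _ _ se]) (use Ak x in simp_all)
    also have "upull A' (\<lambda>j. s e (inv \<pi> j)) = upull A' (s e')"
      by (rule upull_cong) (rule s_back)
    also have "upull A' (s e') x = uproj \<omega> X A' (Tm e' x)"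
      unfolding uproj_eq
      by (rule upull_upull[OF _ _ s_inj[OF e(2)] s_in[OF e(2)], symmetric]) (use Ak x in simp_all)
    finally show "uproj \<omega> X A' (upull {1..k} (\<lambda>j. s e (inv \<pi> j)) x) = uproj \<omega> X A' (Tm e' x)" .
  qed
  finally show ?thesis .
qed

text \<open>An arbitrary edge and index set presenting \<open>C\<close>; by
  \<open>F_consistent\<close> the choice does not influence \<open>G C\<close> on the power over
  \<open>[n]\<close>.\<close>

definition rep :: "nat set \<Rightarrow> nat set \<times> nat set" where
  "rep C = (SOME eA. fst eA \<in> K \<and> snd eA \<in> NE \<and> s (fst eA) ` snd eA = C)"

definition G :: "nat set \<Rightarrow> 'a upoint \<Rightarrow> real" where
  "G C x = F (snd (rep C)) (Tm (fst (rep C)) x)"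

lemma rep: "C \<in> ES \<Longrightarrow> fst (rep C) \<in> K \<and> snd (rep C) \<in> NE \<and> s (fst (rep C)) ` snd (rep C) = C"
  unfolding rep_def by (rule someI_ex[OF ES_rep])

lemma G_eq:
  assumes "e \<in> K" "A \<in> NE" "x \<in> pw {1..n}"
  shows "G (s e ` A) x = F A (Tm e x)"
  unfolding G_def using rep[OF image_in_ES[OF assms(1,2)]] assms by (intro F_consistent) auto

lemma vimage_G:
  assumes C: "C \<in> ES"
  shows "G C -` U \<inter> pw {1..n} = Tm (fst (rep C)) -` (F (snd (rep C)) -` U \<inter> pw {1..k}) \<inter> pw {1..n}"
proof -
  have "Tm (fst (rep C)) x \<in> pw {1..k}" if "x \<in> pw {1..n}" for x
    by (rule upull_in[OF _ _ s_inj s_in]) (use rep[OF C] that in auto)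
  then show ?thesis by (auto simp: G_def)
qed

lemma measurable_G: "C \<in> ES \<Longrightarrow> G C \<in> M {1..n} \<rightarrow>\<^sub>M unit_interval"
  unfolding G_def[abs_def]
  by (rule measurable_compose[OF measurable_upull measurable_F])
    (use rep s_inj s_in in auto)

lemma coord_approx_G:
  assumes C: "C \<in> ES" and U: "U \<in> sets unit_interval"
  shows "coord_approx {1..n} C (G C -` U \<inter> pw {1..n})"
proof -
  define e A where "e = fst (rep C)" and "A = snd (rep C)"
  have eA: "e \<in> K" "A \<in> NE" "s e ` A = C" using rep[OF C] by (simp_all add: e_def A_def)
  have "coord_approx {1..k} A (F A -` U \<inter> pw {1..k})"
    using sigma_proj_approx[OF nonempty_subsetsD[OF eA(2)]] vimage_F_in_l[OF eA(2) U]
      realizationD(2)[OF eA(2)] by blast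
  then have "coord_approx {1..n} (s e ` A) (Tm e -` (F A -` U \<inter> pw {1..k}) \<inter> pw {1..n})"
    using nonempty_subsetsD[OF eA(2)]
    by (intro coord_approx_upull s_inj s_in eA) simp_all
  then show ?thesis unfolding eA(3) unfolding vimage_G[OF C] e_def A_def .
qed

lemma measure_vimage_F: "A \<in> NE \<Longrightarrow> U \<in> sets unit_interval \<Longrightarrow>
   measure (M {1..k}) (F A -` U \<inter> pw {1..k}) = measure unit_interval U"
  unfolding measure_def by (simp only: emeasure_vimage_F)

lemma measure_joint_G:
  assumes U: "\<And>C. U C \<in> sets unit_interval" and D: "\<D> \<subseteq> ES"
  shows "measure (M {1..n}) (pw {1..n} \<inter> (\<Inter>C\<in>\<D>. G C -` U C \<inter> pw {1..n})) =
    (\<Prod>C\<in>\<D>. measure unit_interval (U C))"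
proof -
  have "finite \<D>" using D finite_ES finite_subset by blast
  then show ?thesis
    using D
  proof (induction \<D> rule: finite_ranking_induct[where f = card])
    case empty
    interpret prob_space "M {1..n}" by (rule prob_space_M) simp
    show ?case using prob_space by (simp add: space_M)
  next
    case (insert C \<D>)
    show ?case
    proof (cases "C \<in> \<D>")
      case True
      then show ?thesis using insert by (simp add: insert_absorb)
    next
      case False
      have C: "C \<in> ES" and DE: "\<D> \<subseteq> ES" using insert.prems by auto
      define e A where "e = fst (rep C)" and "A = snd (rep C)"
      have eA: "e \<in> K" "A \<in> NE" "s e ` A = C" using rep[OF C] by (simp_all add: e_def A_def)
      let ?T = "\<lambda>C. G C -` U C \<inter> pw {1..n}"
      \<comment> \<open>The ranking induction adds \<open>C\<close> when its size is at least that
        of every \<open>D\<close> already present, so an inclusion \<open>C \<subseteq> D\<close> of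
        finite sets would be an equality.\<close>
      have nsub: "\<not> s e ` A \<subseteq> D" if "D \<in> \<D>" for D
      proof
        assume "s e ` A \<subseteq> D"
        then have "C \<subseteq> D" by (simp add: eA)
        moreover have "finite D" using DE that finite_in_ES by blast
        ultimately have "C = D" using insert.hyps(2)[OF that] by (intro card_seteq)
        with False that show False by simp
      qed
      have approx: "coord_approx {1..n} D (?T D)" if "D \<in> \<D>" for D
        by (rule coord_approx_G[OF subsetD[OF DE that] U])
      have TC: "?T C = Tm e -` (F A -` U C \<inter> pw {1..k}) \<inter> pw {1..n}"
        unfolding vimage_G[OF C] e_def A_def ..
      have eq: "pw {1..n} \<inter> (\<Inter>C\<in>insert C \<D>. ?T C) =
          (Tm e -` (F A -` U C \<inter> pw {1..k}) \<inter> pw {1..n}) \<inter> (pw {1..n} \<inter> (\<Inter>C\<in>\<D>. ?T C))"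
        unfolding TC[symmetric] by blast
      have "measure (M {1..n}) (pw {1..n} \<inter> (\<Inter>C\<in>insert C \<D>. ?T C)) =
          measure (M {1..k}) (F A -` U C \<inter> pw {1..k}) * measure (M {1..n}) (pw {1..n} \<inter> (\<Inter>C\<in>\<D>. ?T C))"
        unfolding eq
        by (rule measure_Int_eq_mult[OF eA(2) vimage_F_in_l[OF eA(2) U] finite_atLeastAtMost
              s_inj[OF eA(1)] s_in[OF eA(1)] insert.hyps(1) nsub approx])
      then show ?thesis
        unfolding measure_vimage_F[OF eA(2) U] insert.IH[OF DE] using insert.hyps(1) False by simp
    qed
  qed
qed

section \<open>The joint law on the cube and the comparison of densities\<close>

abbreviation "PE \<equiv> \<Pi>\<^sub>M C\<in>ES. unit_interval"
abbreviation "PN \<equiv> \<Pi>\<^sub>M A\<in>NE. unit_interval"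

definition Gv :: "'a upoint \<Rightarrow> nat set \<Rightarrow> real" where
  "Gv x = (\<lambda>C\<in>ES. G C x)"

definition \<Psi> :: "nat set \<Rightarrow> (nat set \<Rightarrow> real) \<Rightarrow> nat set \<Rightarrow> real" where
  "\<Psi> e x = (\<lambda>A\<in>NE. x (s e ` A))"

lemma measurable_Gv: "Gv \<in> M {1..n} \<rightarrow>\<^sub>M PE"
  unfolding Gv_def[abs_def] by (intro measurable_restrict measurable_G)

lemma distr_Gv: "distr (M {1..n}) PE Gv = PE"
proof -
  interpret product_sigma_finite "\<lambda>_ :: nat set. unit_interval"
    unfolding product_sigma_finite_def
    using prob_space_imp_sigma_finite[OF prob_space_unit_interval] ..
  interpret N: prob_space "M {1..n}" by (rule prob_space_M) simp
  show ?thesis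
  proof (rule PiM_eqI[OF finite_ES])
    fix U :: "nat set \<Rightarrow> real set" assume U: "\<And>C. C \<in> ES \<Longrightarrow> U C \<in> sets unit_interval"
    \<comment> \<open>\<open>measure_joint_G\<close> asks for a measurable set at every index, so
      \<open>U\<close> gets a harmless value outside \<open>ES\<close>.\<close>
    define U' where "U' C = (if C \<in> ES then U C else {})" for C
    have U': "U' C \<in> sets unit_interval" for C using U by (simp add: U'_def)
    have "Gv -` Pi\<^sub>E ES U \<inter> pw {1..n} = pw {1..n} \<inter> (\<Inter>C\<in>ES. G C -` U' C \<inter> pw {1..n})"
      by (auto simp: Gv_def PiE_iff U'_def)
    then have "emeasure (distr (M {1..n}) PE Gv) (Pi\<^sub>E ES U) =
        emeasure (M {1..n}) (pw {1..n} \<inter> (\<Inter>C\<in>ES. G C -` U' C \<inter> pw {1..n}))"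
      by (subst emeasure_distr[OF measurable_Gv])
        (use U finite_ES in \<open>auto intro!: sets_PiM_I_finite simp: space_M\<close>)
    also have "\<dots> = ennreal (\<Prod>C\<in>ES. measure unit_interval (U' C))"
      unfolding N.emeasure_eq_measure measure_joint_G[OF U' subset_refl] ..
    also have "\<dots> = (\<Prod>C\<in>ES. emeasure unit_interval (U C))"
      using prob_space_unit_interval
      by (simp add: U'_def finite_measure.emeasure_eq_measure prob_space.finite_measure prod_ennreal cong: prod.cong)
    finally show "emeasure (distr (M {1..n}) PE Gv) (Pi\<^sub>E ES U) = (\<Prod>C\<in>ES. emeasure unit_interval (U C))" .
  qed simp
qed

text \<open>The link between both sides: the argument of \<open>W\<close> at the edge
  \<open>e\<close> in \<open>limit_density\<close>, evaluated at the random point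
  \<open>Gv x\<close>, is the value of the direct sum map at the tuple that \<open>x\<close> places
  on \<open>e\<close>.\<close>

lemma \<Psi>_Gv:
  assumes "e \<in> K" "x \<in> pw {1..n}"
  shows "\<Psi> e (Gv x) = direct_sum_map k F (Tm e x)"
  using assms by (auto simp: \<Psi>_def Gv_def direct_sum_map_def image_in_ES G_eq fun_eq_iff)

lemma measurable_\<Psi>: "e \<in> K \<Longrightarrow> \<Psi> e \<in> PE \<rightarrow>\<^sub>M PN"
  unfolding \<Psi>_def[abs_def]
  by (intro measurable_restrict measurable_component_singleton image_in_ES)

lemma sets_Collect_\<Psi>:
  assumes "Q \<in> sets PN"
  shows "{x \<in> space PE. \<forall>e\<in>K. \<Psi> e x \<in> Q} \<in> sets PE"
proof (rule sets.sets_Collect_finite_All[OF _ finite_K])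
  fix e assume "e \<in> K"
  from measurable_sets[OF measurable_\<Psi>[OF this] assms]
  show "{x \<in> space PE. \<Psi> e x \<in> Q} \<in> sets PE" by (simp add: vimage_def Int_def conj_commute)
qed

text \<open>As \<open>s e\<close> is injective, distinct index sets have distinct images. So
  \<open>\<Psi> e\<close> selects and renames distinct coordinates of the cube, which keeps the
  product measure.\<close>

lemma distr_\<Psi>:
  assumes e: "e \<in> K"
  shows "distr PE PN (\<Psi> e) = PN"
proof -
  have "inj_on ((`) (s e)) NE"
    by (rule inj_on_subset[OF inj_on_image_Pow[OF s_inj[OF e]]]) (auto simp: nonempty_subsets_def)
  then show ?thesis
    unfolding \<Psi>_def[abs_def]
    using image_in_ES[OF e] prob_space_unit_interval
    by (intro distr_PiM_reindex[of ES "\<lambda>_. unit_interval" "(`) (s e)" NE]) auto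
qed

lemma null_\<Psi>:
  assumes "e \<in> K" "N \<in> null_sets PN"
  shows "\<Psi> e -` N \<inter> space PE \<in> null_sets PE"
proof -
  have "emeasure (distr PE PN (\<Psi> e)) N = 0" unfolding distr_\<Psi>[OF assms(1)] using assms by auto
  then show ?thesis
    using emeasure_distr[OF measurable_\<Psi>[OF assms(1)], of N]
      measurable_sets[OF measurable_\<Psi>[OF assms(1)], of N] assms(2)
    by (auto simp: null_sets_def)
qed

lemma null_Gv:
  assumes "N \<in> null_sets PE"
  shows "Gv -` N \<inter> pw {1..n} \<in> null_sets (M {1..n})"
proof -
  have "emeasure (distr (M {1..n}) PE Gv) N = 0" unfolding distr_Gv using assms by auto
  then show ?thesis
    using emeasure_distr[OF measurable_Gv, of N] measurable_sets[OF measurable_Gv, of N] assms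
    by (auto simp: null_sets_def space_M)
qed

text \<open>The integrand is the indicator of \<open>Z\<close>, which is measurable only for the
  completion because \<open>Q\<close> is. Replacing \<open>Q\<close> by \<open>Q'\<close> changes
  \<open>Z\<close> only inside \<open>B\<close>, a finite union of preimages of the null set
  \<open>N'\<close>, and gives a set measurable for the product itself.\<close>

lemma limit_density_eq_measure:
  assumes Q: "Q = Q' \<union> N" "N \<subseteq> N'" "N' \<in> null_sets PN" "Q' \<in> sets PN"
  shows "limit_density k s K (indicator Q) = measure PE {x \<in> space PE. \<forall>e\<in>K. \<Psi> e x \<in> Q'}"
proof -
  define Z where "Z = {x \<in> space PE. \<forall>e\<in>K. \<Psi> e x \<in> Q}"
  define Z' where "Z' = {x \<in> space PE. \<forall>e\<in>K. \<Psi> e x \<in> Q'}"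
  define B where "B = (\<Union>e\<in>K. \<Psi> e -` N' \<inter> space PE)"
  have B: "B \<in> null_sets PE"
    unfolding B_def using null_\<Psi> Q(3) finite_K by (intro null_sets_UN') (auto intro: countable_finite)
  have Z': "Z' \<in> sets PE" unfolding Z'_def by (rule sets_Collect_\<Psi>[OF Q(4)])
  have Z_sub: "Z' \<subseteq> Z" "Z \<subseteq> Z' \<union> B" using Q(1,2) by (auto simp: Z_def Z'_def B_def)
  have Z: "Z \<in> sets (completion PE)"
    by (rule sets_completionI[of Z Z' "Z - Z'" B PE]) (use Z_sub Z' B in auto)
  have "limit_density k s K (indicator Q) = (LINT x|completion PE. indicator Z x)"
    unfolding limit_density_def unit_cube_def
  proof (rule Bochner_Integration.integral_cong[OF refl])
    fix x assume "x \<in> space (completion PE)"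
    then show "(\<Prod>e\<in>K. indicator Q (\<lambda>A\<in>NE. x (s e ` A))) = (indicator Z x :: real)"
      using finite_K by (auto simp: Z_def \<Psi>_def indicator_def prod_zero_iff intro!: prod.neutral)
  qed
  also have "\<dots> = measure (completion PE) Z"
    using Z sets.sets_into_space[OF Z] by (simp add: Int_absorb2 Int_absorb1 del: space_completion)
  also have "\<dots> = measure (completion PE) Z'"
  proof (rule measure_eq_AE[OF _ Z])
    have "AE x in PE. x \<notin> B" using B by (rule AE_not_in)
    then have "AE x in completion PE. x \<notin> B" by (rule AE_completion)
    then show "AE x in completion PE. x \<in> Z \<longleftrightarrow> x \<in> Z'"
      by eventually_elim (use Z_sub in auto)
  qed (use Z' in simp)
  also have "\<dots> = measure PE Z'" using Z' by simp
  finally show ?thesis unfolding Z'_def .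
qed

theorem hom_density_tendsto:
  assumes Q: "Q \<in> sets (unit_cube NE)"
    and H: "sym_diff (direct_sum_map k F -` Q \<inter> pw {1..k})
      (intern {1..k} (\<lambda>i. edge_tuples k (X i) (H i))) \<in> null_sets (M {1..k})"
  shows "((\<lambda>i. hom_density n K (X i) (H i)) \<longlongrightarrow> limit_density k s K (indicator Q)) \<omega>"
proof -
  obtain Q' N N' where Q': "Q = Q' \<union> N" "N \<subseteq> N'" "N' \<in> null_sets PN" "Q' \<in> sets PN"
    by (rule sets_completionE[OF Q[unfolded unit_cube_def]])
  interpret N: ultra_space \<omega> "powers X {1..n}" by (rule ultra_space_powers) simp
  let ?E = "\<lambda>i. edge_tuples k (X i) (H i)" and ?hom = "\<lambda>i. homs n K (X i) (H i)"
  define Z where "Z = {x \<in> space PE. \<forall>e\<in>K. \<Psi> e x \<in> Q'}"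
  have homs: "N.internal ?hom = pw {1..n} \<inter> (\<Inter>e\<in>K. Tm e -` intern {1..k} ?E \<inter> pw {1..n})"
  proof -
    have "N.internal ?hom = N.internal (\<lambda>i. powers X {1..n} i \<inter> (\<Inter>e\<in>K. pull {1..k} (s e) -` ?E i))"
    proof (rule N.internal_cong)
      fix i
      have "pull {1..k} (s e) x \<in> ?E i \<longleftrightarrow> x ` e \<in> H i" if "e \<in> K" "x \<in> powers X {1..n} i" for e x
      proof -
        have "pull {1..k} (s e) x ` {1..k} = x ` (s e ` {1..k})"
          unfolding image_image by (rule image_cong) (simp_all add: pull_def)
        then have "pull {1..k} (s e) x ` {1..k} = x ` e" by (simp only: s_image[OF that(1)])
        moreover have "pull {1..k} (s e) x \<in> {1..k} \<rightarrow>\<^sub>E X i"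
          using pull_in[OF s_in[OF that(1)]] that(2) unfolding powers_def by blast
        ultimately show ?thesis by (simp add: edge_tuples_def)
      qed
      then show "?hom i \<inter> powers X {1..n} i =
          powers X {1..n} i \<inter> (\<Inter>e\<in>K. pull {1..k} (s e) -` ?E i) \<inter> powers X {1..n} i"
        by (auto simp: homs_def powers_def)
    qed
    also have "\<dots> = pw {1..n} \<inter> (\<Inter>e\<in>K. N.internal (\<lambda>i. pull {1..k} (s e) -` ?E i))"
      unfolding upower_def by (rule N.internal_INT_finite[OF finite_K])
    also have "(\<Inter>e\<in>K. N.internal (\<lambda>i. pull {1..k} (s e) -` ?E i)) =
        (\<Inter>e\<in>K. Tm e -` intern {1..k} ?E \<inter> pw {1..n})"
      by (rule INF_cong[OF refl], rule vimage_upull_intern[symmetric])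
        (use s_inj s_in in simp_all)
    finally show ?thesis .
  qed
  have "N.null (sym_diff (Gv -` Z \<inter> pw {1..n}) (N.internal ?hom))"
  proof -
    \<comment> \<open>The two ways in which \<open>e\<close> can spoil the comparison: the tuple on
      \<open>e\<close> lies where the preimage of \<open>Q\<close> differs from the limit
      hypergraph, or the point of the cube falls into \<open>N'\<close>, where \<open>Q\<close> may
      differ from \<open>Q'\<close>. Both have measure zero.\<close>
    define BAD where "BAD e = (Tm e -` sym_diff (direct_sum_map k F -` Q \<inter> pw {1..k}) (intern {1..k} ?E)
       \<inter> pw {1..n}) \<union> (Gv -` (\<Psi> e -` N' \<inter> space PE) \<inter> pw {1..n})" for e
    have "BAD e \<in> null_sets (M {1..n})" if "e \<in> K" for e
      unfolding BAD_def
      by (intro null_sets.Un null_upull[OF _ _ s_inj[OF that] s_in[OF that] H] null_Gv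
          null_\<Psi>[OF that Q'(3)]) simp_all
    then have "(\<Union>e\<in>K. BAD e) \<in> null_sets (M {1..n})"
      using finite_K by (intro null_sets_UN') (auto intro: countable_finite)
    then have "N.null (\<Union>e\<in>K. BAD e)" by (simp add: null_sets_M)
    then show ?thesis
    proof (rule N.null_subset)
      have key: "\<Psi> e (Gv x) \<in> Q' \<longleftrightarrow> Tm e x \<in> intern {1..k} ?E"
        if x: "x \<in> pw {1..n}" and e: "e \<in> K" and nb: "x \<notin> BAD e" for x e
      proof -
        have Gs: "Gv x \<in> space PE"
          using measurable_space[OF measurable_Gv, of x] x by (simp add: space_M)
        have Tx: "Tm e x \<in> pw {1..k}"
          by (rule upull_in[OF _ _ s_inj[OF e] s_in[OF e] x]) simp_all
        have "direct_sum_map k F (Tm e x) \<in> Q \<longleftrightarrow> Tm e x \<in> intern {1..k} ?E"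
          using nb x Tx unfolding BAD_def by blast
        moreover have "\<Psi> e (Gv x) \<notin> N'" using nb x Gs unfolding BAD_def by blast
        ultimately show ?thesis using Q'(1,2) \<Psi>_Gv[OF e x] by auto
      qed
      have Gs: "Gv x \<in> space PE" if "x \<in> pw {1..n}" for x
        using measurable_space[OF measurable_Gv, of x] that by (simp add: space_M)
      show "sym_diff (Gv -` Z \<inter> pw {1..n}) (N.internal ?hom) \<subseteq> (\<Union>e\<in>K. BAD e)"
        unfolding homs
      proof
        fix x assume x: "x \<in> sym_diff (Gv -` Z \<inter> pw {1..n})
          (pw {1..n} \<inter> (\<Inter>e\<in>K. Tm e -` intern {1..k} ?E \<inter> pw {1..n}))"
        then have xn: "x \<in> pw {1..n}" by blast
        show "x \<in> (\<Union>e\<in>K. BAD e)"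
        proof (rule ccontr)
          assume "x \<notin> (\<Union>e\<in>K. BAD e)"
          then have "\<forall>e\<in>K. \<Psi> e (Gv x) \<in> Q' \<longleftrightarrow> Tm e x \<in> intern {1..k} ?E" using key[OF xn] by blast
          with x xn Gs[OF xn] show False unfolding Z_def by blast
        qed
      qed
    qed
  qed
  then have "measure N.LM (Gv -` Z \<inter> pw {1..n}) = N.lim_dens ?hom"
    by (intro N.measure_eq_lim_dens) (auto simp: upower_def)
  moreover have "measure (M {1..n}) (Gv -` Z \<inter> pw {1..n}) = measure PE Z"
  proof -
    have "Z \<in> sets PE" unfolding Z_def by (rule sets_Collect_\<Psi>[OF Q'(4)])
    then have "measure (distr (M {1..n}) PE Gv) Z = measure (M {1..n}) (Gv -` Z \<inter> pw {1..n})"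
      using measure_distr[OF measurable_Gv, of Z] by (simp add: space_M)
    then show ?thesis unfolding distr_Gv ..
  qed
  ultimately have "N.lim_dens ?hom = limit_density k s K (indicator Q)"
    unfolding limit_density_eq_measure[OF Q'] Z_def by (simp only: upower_measure_def)
  moreover have dens: "N.dens ?hom i = hom_density n K (X i) (H i)" for i
  proof -
    have "?hom i \<inter> powers X {1..n} i = ?hom i" by (auto simp: homs_def powers_def)
    moreover have "card (powers X {1..n} i) = card (X i) ^ n" by (simp add: powers_def card_PiE)
    ultimately show ?thesis unfolding N.dens_def hom_density_def by simp
  qed
  ultimately show ?thesis using N.dens_tendsto[of ?hom] unfolding dens[abs_def] by simp
qed

end

theorem mainTheorem17:
  fixes \<omega> :: "nat filter"
    and X :: "nat \<Rightarrow> 'a set"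
    and k n :: nat
    and H :: "nat \<Rightarrow> 'a set set"
    and l :: "nat set \<Rightarrow> 'a upoint set set"
    and F :: "nat set \<Rightarrow> 'a upoint \<Rightarrow> real"
    and Q :: "(nat set \<Rightarrow> real) set"
    and K :: "nat set set"
    and s :: "nat set \<Rightarrow> nat \<Rightarrow> nat"
  assumes "nonprincipal_ultrafilter \<omega>"
    and "\<And>i. finite (X i)"
    and "strict_mono (\<lambda>i. card (X i))"
    and "\<And>i. uniform_hypergraph k (X i) (H i)"
    and "separable_realization \<omega> X k l F"
    and "Q \<in> sets (unit_cube (nonempty_subsets k))"
    and "perm_invariant k Q"
    and "sym_diff (direct_sum_map k F -` Q \<inter> upower \<omega> X {1..k})
           (internal_set \<omega> (powers X {1..k}) (\<lambda>i. edge_tuples k (X i) (H i)))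
         \<in> null_sets (upower_measure \<omega> X {1..k})"
    and "uniform_hypergraph k {1..n} K"
    and "\<And>e. e \<in> K \<Longrightarrow> bij_betw (s e) {1..k} e"
  shows "((\<lambda>i. hom_density n K (X i) (H i)) \<longlongrightarrow> limit_density k s K (indicator Q)) \<omega>"
proof -
  have ne_Suc: "X (Suc i) \<noteq> {}" for i
    using strict_monoD[OF assms(3), of i "Suc i"] by auto
  show ?thesis
  proof (cases "k = 0")
    case False
    \<comment> \<open>Strict growth of the cardinalities leaves only \<open>X 0\<close> in doubt.
      Representatives must lie in the given set at every index, so an empty \<open>X 0\<close> would
      empty the whole ultraproduct when \<open>k > 0\<close>. This contradicts that
      \<open>F {1..k}\<close> carries its measure to one of total mass 1.\<close>
    have "X 0 \<noteq> {}"
    proof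
      assume "X 0 = {}"
      then have "powers X {1..k} 0 = {}" using False by (auto simp: powers_def PiE_eq_empty_iff)
      then have "upower \<omega> X {1..k} = {}"
        by (auto simp: upower_def ultraproduct_def quotient_def)
      moreover have "{1..k} \<in> nonempty_subsets k" using False by (simp add: nonempty_subsets_def)
      then have "induces_measure_algebra_iso
          (measure_of (upower \<omega> X {1..k}) (l {1..k}) (emeasure (upower_measure \<omega> X {1..k})))
          unit_interval (F {1..k})"
        using assms(5) unfolding separable_realization_def Let_def by blast
      moreover have "space unit_interval \<in> sets unit_interval" by simp
      ultimately have "emeasure unit_interval (space unit_interval) = 0"
        unfolding induces_measure_algebra_iso_def
        by (metis Int_empty_right emeasure_empty space_empty_iff space_measure_of_conv)
      then show False using prob_space.emeasure_space_1[OF prob_space_unit_interval] by simp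
    qed
    then have "X i \<noteq> {}" for i using ne_Suc by (cases i) auto
    then interpret realization_hypergraph \<omega> X k l F n K s
      by unfold_locales (use assms in auto)
    show ?thesis by (rule hom_density_tendsto[OF assms(6,8)])
  next
    case True
    txt \<open>Here \<open>X 0\<close> may be empty, which makes the ultraproduct of the powers \<open>X i ^ n\<close> empty;
      changing \<open>X 0\<close> affects neither the hypotheses nor the limit.\<close>
    define X' where "X' = X(0 := X 1)"
    have pw: "powers X' {1..k} = powers X {1..k}" using True by (simp add: powers_def fun_eq_iff)
    interpret realization_hypergraph \<omega> X' k l F n K s
    proof unfold_locales
      show "separable_realization \<omega> X' k l F"
        using True by (simp add: separable_realization_def nonempty_subsets_def)
      show "X' i \<noteq> {}" for i using ne_Suc by (cases i) (auto simp: X'_def)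
    qed (use assms in \<open>auto simp: X'_def\<close>)
    have "edge_tuples k (X' i) (H i) = edge_tuples k (X i) (H i)" for i
      using True by (simp add: edge_tuples_def)
    then have lim: "((\<lambda>i. hom_density n K (X' i) (H i)) \<longlongrightarrow> limit_density k s K (indicator Q)) \<omega>"
      using assms(6,8) by (intro hom_density_tendsto) (simp_all only: upower_def upower_measure_def pw)
    have ev: "\<forall>\<^sub>F i in \<omega>. hom_density n K (X' i) (H i) = hom_density n K (X i) (H i)"
      using eventually_ge[of 1] by eventually_elim (simp add: X'_def)
    show ?thesis by (rule iffD1[OF tendsto_cong[OF ev] lim])
  qed
qed

end
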